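(* Let $\mathcal{H}$ be a complex Hilbert space, let $S,T\in\mathcal{B}(\mathcal{H})$ and let $\lambda\in(0,1)$. Then $$M_\lambda(S\otimes T)=M_\lambda(S)\otimes M_\lambda(T)$$ if and only if at least one of the following holds: (i) $S$ is quasinormal; (ii) $T$ is quasinormal.
   Context: $\mathcal{B}(\mathcal{H})$ denotes the bounded linear operators on $\mathcal{H}$. For a bounded operator $T$, $|T|=(T^*T)^{1/2}$ and $T=U|T|$ is the canonical polar decomposition ($U$ a partial isometry with $\ker U=\ker T$). The Duggal transform is $T^D=|T|U$, and the $\lambda$-mean transform is $M_\lambda(T)=\lambda T+(1-\lambda)T^D$ for $\lambda\in[0,1]$. $S\otimes T$ is the tensor product operator on the Hilbert space tensor product $\mathcal{H}\otimes\mathcal{H}$, determined by $(S\otimes T)(x\otimes y)=Sx\otimes Ty$. An operator $T$ is quasinormal if it commutes with $T^*T$. *)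

theory Defs
  imports "HOL-Analysis.Analysis"
begin

section \<open>Complex Hilbert spaces\<close>

class complex_vector = real_vector +
  fixes scaleC :: "complex \<Rightarrow> 'a \<Rightarrow> 'a" (infixr "*\<^sub>C" 75)
  assumes scaleC_add_right: "a *\<^sub>C (x + y) = a *\<^sub>C x + a *\<^sub>C y"
    and scaleC_add_left: "(a + b) *\<^sub>C x = a *\<^sub>C x + b *\<^sub>C x"
    and scaleC_scaleC: "a *\<^sub>C b *\<^sub>C x = (a * b) *\<^sub>C x"
    and scaleC_one: "1 *\<^sub>C x = x"
    and scaleR_scaleC: "r *\<^sub>R x = complex_of_real r *\<^sub>C x"

global_interpretation complex_vector: vector_space "scaleC :: complex \<Rightarrow> 'a \<Rightarrow> 'a::complex_vector"
  by standard (simp_all add: scaleC_add_right scaleC_add_left scaleC_scaleC scaleC_one)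

text \<open>The inner product is conjugate-linear in its first argument. Building on \<^class>\<open>real_inner\<close>
  gives \<open>norm x = sqrt (Re (cinner x x))\<close> together with positive definiteness of \<open>cinner\<close>.\<close>

class complex_inner = complex_vector + real_inner +
  fixes cinner :: "'a \<Rightarrow> 'a \<Rightarrow> complex"
  assumes cinner_commute: "cinner x y = cnj (cinner y x)"
    and cinner_add_left: "cinner (x + y) z = cinner x z + cinner y z"
    and cinner_scaleC_left: "cinner (c *\<^sub>C x) y = cnj c * cinner x y"
    and inner_eq_Re_cinner: "inner x y = Re (cinner x y)"

class chilbert_space = complex_inner + banach

instantiation complex :: chilbert_space
begin

definition scaleC_complex :: "complex \<Rightarrow> complex \<Rightarrow> complex"
  where "scaleC_complex c x = c * x"

definition cinner_complex :: "complex \<Rightarrow> complex \<Rightarrow> complex"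
  where "cinner_complex x y = cnj x * y"

instance
  by standard
    (simp_all add: scaleC_complex_def cinner_complex_def inner_complex_def algebra_simps
      scaleR_conv_of_real)

end


section \<open>Bounded operators\<close>

definition bounded_clinear :: "('a::complex_inner \<Rightarrow> 'b::complex_inner) \<Rightarrow> bool"
  where "bounded_clinear T \<longleftrightarrow> bounded_linear T \<and> (\<forall>c x. T (c *\<^sub>C x) = c *\<^sub>C T x)"

definition cadjoint :: "('a::chilbert_space \<Rightarrow> 'b::chilbert_space) \<Rightarrow> 'b \<Rightarrow> 'a"
  where "cadjoint T =
    (THE T'. bounded_clinear T' \<and> (\<forall>x y. cinner (T x) y = cinner x (T' y)))"

definition positive_op :: "('a::chilbert_space \<Rightarrow> 'a) \<Rightarrow> bool"
  where "positive_op P \<longleftrightarrow> bounded_clinear P \<and> (\<forall>x. cinner x (P x) \<in> \<real>\<^sub>\<ge>\<^sub>0)"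

definition sqrt_op :: "('a::chilbert_space \<Rightarrow> 'a) \<Rightarrow> 'a \<Rightarrow> 'a"
  where "sqrt_op A = (THE P. positive_op P \<and> P \<circ> P = A)"

definition abs_op :: "('a::chilbert_space \<Rightarrow> 'a) \<Rightarrow> 'a \<Rightarrow> 'a"
  where "abs_op T = sqrt_op (cadjoint T \<circ> T)"

text \<open>A partial isometry is isometric on the orthogonal complement of its kernel.\<close>

definition partial_isometry :: "('a::chilbert_space \<Rightarrow> 'b::chilbert_space) \<Rightarrow> bool"
  where "partial_isometry U \<longleftrightarrow> bounded_clinear U \<and>
    (\<forall>x. (\<forall>y. U y = 0 \<longrightarrow> cinner y x = 0) \<longrightarrow> norm (U x) = norm x)"

text \<open>The partial isometry \<open>U\<close> of the canonical polar decomposition \<open>T = U |T|\<close>.\<close>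

definition polar_op :: "('a::chilbert_space \<Rightarrow> 'a) \<Rightarrow> 'a \<Rightarrow> 'a"
  where "polar_op T =
    (THE U. partial_isometry U \<and> {x. U x = 0} = {x. T x = 0} \<and> T = U \<circ> abs_op T)"

definition duggal_transform :: "('a::chilbert_space \<Rightarrow> 'a) \<Rightarrow> 'a \<Rightarrow> 'a"
  where "duggal_transform T = abs_op T \<circ> polar_op T"

definition mean_transform :: "real \<Rightarrow> ('a::chilbert_space \<Rightarrow> 'a) \<Rightarrow> 'a \<Rightarrow> 'a"
  where "mean_transform l T = (\<lambda>x. l *\<^sub>R T x + (1 - l) *\<^sub>R duggal_transform T x)"

definition quasinormal :: "('a::chilbert_space \<Rightarrow> 'a) \<Rightarrow> bool"
  where "quasinormal T \<longleftrightarrow> T \<circ> (cadjoint T \<circ> T) = (cadjoint T \<circ> T) \<circ> T"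


section \<open>Hilbert space tensor products\<close>

text \<open>\<open>hilbert_tensor t\<close> says that the Hilbert space \<open>'k\<close>, with elementary tensors
  \<open>x \<otimes> y = t x y\<close>, is the Hilbert space tensor product of \<open>'a\<close> and \<open>'b\<close>: \<open>t\<close> is bilinear,
  inner products of elementary tensors factor, and elementary tensors span a dense subspace,
  so that \<open>'k\<close> is the completion of the algebraic tensor product. These conditions determine
  \<open>'k\<close> and \<open>t\<close> up to a unique unitary compatible with the elementary tensors.\<close>

definition hilbert_tensor ::
    "('a::chilbert_space \<Rightarrow> 'b::chilbert_space \<Rightarrow> 'k::chilbert_space) \<Rightarrow> bool"
  where "hilbert_tensor t \<longleftrightarrow>
    (\<forall>x x' y. t (x + x') y = t x y + t x' y) \<and>
    (\<forall>x y y'. t x (y + y') = t x y + t x y') \<and>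
    (\<forall>c x y. t (c *\<^sub>C x) y = c *\<^sub>C t x y) \<and>
    (\<forall>c x y. t x (c *\<^sub>C y) = c *\<^sub>C t x y) \<and>
    (\<forall>x x' y y'. cinner (t x y) (t x' y') = cinner x x' * cinner y y') \<and>
    closure (complex_vector.span {t x y | x y. True}) = UNIV"

lemma hilbert_tensor_complex: "hilbert_tensor ((*) :: complex \<Rightarrow> complex \<Rightarrow> complex)"
proof -
  have "{x * y | x y :: complex. True} = UNIV"
    by (metis (mono_tags, lifting) UNIV_eq_I mem_Collect_eq mult.right_neutral)
  then show ?thesis
    by (simp add: hilbert_tensor_def scaleC_complex_def cinner_complex_def algebra_simps)
qed

definition tensor_op ::
    "('a::chilbert_space \<Rightarrow> 'b::chilbert_space \<Rightarrow> 'k::chilbert_space) \<Rightarrow>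
      ('a \<Rightarrow> 'a) \<Rightarrow> ('b \<Rightarrow> 'b) \<Rightarrow> 'k \<Rightarrow> 'k"
  where "tensor_op t S T = (THE R. bounded_clinear R \<and> (\<forall>x y. R (t x y) = t (S x) (T y)))"

end

theory Submission
  imports Defs
begin

text \<open>Since \<open>|S \<otimes> T| = |S| \<otimes> |T|\<close> and the partial isometries of the polar decompositions also
  multiply, the Duggal transform satisfies \<open>(S \<otimes> T)\<^sup>D = S\<^sup>D \<otimes> T\<^sup>D\<close>. Hence the difference of the two
  sides is \<open>\<lambda> (1 - \<lambda>) (S - S\<^sup>D) \<otimes> (T - T\<^sup>D)\<close>, which vanishes iff \<open>S = S\<^sup>D\<close> or \<open>T = T\<^sup>D\<close>. Finally
  \<open>T = T\<^sup>D\<close> means that \<open>T\<close> commutes with \<open>|T|\<close>, equivalently with \<open>|T|\<^sup>2 = T\<^sup>* T\<close>.\<close>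

section \<open>Complex inner products and bounded operators\<close>

text \<open>The operators involved are given by definite descriptions, so each claim about them
  rests on existence and uniqueness. Adjoints, projections onto closed ranges, polar factors and the
  operators S \<otimes> 1 all arise from one construction: a bounded linear set of pairs has an
  adjoint by Riesz, and a second adjoint extends the prescribed map to the whole space. Pairs are
  used rather than functions because S \<otimes> 1 is prescribed on finite sums of elementary
  tensors, where one vector has many representations; the norm bound makes the prescription
  consistent. For the polar factors the obstacle is the kernel of S \<otimes> T, which has no direct
  description by elementary tensors. The kernel condition is therefore checked on the adjoint side,
  where elementary tensors suffice.\<close>

lemma cinner_add_right: "cinner x (y + z) = cinner x y + cinner x (z::'a::complex_inner)"
  by (metis cinner_commute cinner_add_left complex_cnj_add)

lemma cinner_scaleC_right: "cinner x (c *\<^sub>C y) = c * cinner x (y::'a::complex_inner)"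
  by (metis cinner_commute cinner_scaleC_left complex_cnj_cnj complex_cnj_mult)

lemma cinner_zero_left [simp]: "cinner 0 (y::'a::complex_inner) = 0"
  using cinner_add_left[of 0 0 y] by simp

lemma cinner_zero_right [simp]: "cinner (x::'a::complex_inner) 0 = 0"
  using cinner_add_right[of x 0 0] by simp

lemma cinner_diff_right: "cinner x (y - z) = cinner x y - cinner x (z::'a::complex_inner)"
  using cinner_add_right[of x "y - z" z] by simp

lemma cinner_self: "cinner x x = complex_of_real ((norm (x::'a::complex_inner))\<^sup>2)"
proof -
  have "Im (cinner x x) = 0"
    using arg_cong[OF cinner_commute[of x x], of Im] by simp
  then show ?thesis
    by (simp add: complex_eq_iff dot_square_norm[symmetric] inner_eq_Re_cinner)
qed

lemma Im_cinner: "Im (cinner x y) = inner (\<i> *\<^sub>C x) (y::'a::complex_inner)"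
  by (simp add: inner_eq_Re_cinner cinner_scaleC_left)

text \<open>The imaginary part of \<open>cinner x u\<close> is the real product with
  \<open>\<i> *\<^sub>C x\<close>. This is how identities obtained by real minimisation become
  complex ones.\<close>

lemma cinner_eqI:
  fixes x u :: "'a::complex_inner" and y v :: "'b::complex_inner"
  assumes "inner x u = inner y v" and "inner (\<i> *\<^sub>C x) u = inner (\<i> *\<^sub>C y) v"
  shows "cinner x u = cinner y v"
  using assms by (simp add: complex_eq_iff Im_cinner) (simp add: inner_eq_Re_cinner)

lemma cinner_ext:
  fixes u v :: "'a::complex_inner"
  assumes "\<And>x. cinner x u = cinner x v"
  shows "u = v"
  using assms[of "u - v"] cinner_self[of "u - v"] by (simp add: cinner_diff_right)

lemma inner_scaleC_left: "inner (c *\<^sub>C x) y = inner x (cnj c *\<^sub>C (y::'a::complex_inner))"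
  by (simp add: inner_eq_Re_cinner cinner_scaleC_left cinner_scaleC_right)

lemma norm_scaleC: "norm (c *\<^sub>C (x::'a::complex_inner)) = cmod c * norm x"
proof -
  have "complex_of_real ((norm (c *\<^sub>C x))\<^sup>2) = cnj c * c * complex_of_real ((norm x)\<^sup>2)"
    by (metis cinner_self cinner_scaleC_left cinner_scaleC_right mult.assoc mult.left_commute)
  also have "\<dots> = complex_of_real ((cmod c * norm x)\<^sup>2)"
    by (simp add: complex_norm_square[of c, simplified] power_mult_distrib mult.commute)
  finally show ?thesis
    by (metis of_real_eq_iff norm_ge_zero mult_nonneg_nonneg power2_eq_iff_nonneg)
qed

lemma scaleC_scaleR_commute: "c *\<^sub>C r *\<^sub>R x = r *\<^sub>R c *\<^sub>C (x::'a::complex_vector)"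
  by (simp add: scaleR_scaleC scaleC_scaleC mult.commute)

lemma bounded_linear_scaleC: "bounded_linear (\<lambda>x. c *\<^sub>C (x::'a::complex_inner))"
  by (rule bounded_linear_intro[where K = "cmod c"])
    (auto simp: scaleC_add_right scaleC_scaleR_commute norm_scaleC mult.commute)

lemma bounded_clinear_id [simp]: "bounded_clinear (id :: 'a::complex_inner \<Rightarrow> 'a)"
  by (simp add: bounded_clinear_def id_def)

lemma bounded_clinear_compose:
  "bounded_clinear (f :: 'b::complex_inner \<Rightarrow> 'c::complex_inner) \<Longrightarrow>
    bounded_clinear (g :: 'a::complex_inner \<Rightarrow> 'b) \<Longrightarrow> bounded_clinear (f \<circ> g)"
  by (auto simp: bounded_clinear_def o_def intro: bounded_linear_compose)

lemma bounded_clinear_add: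
  "bounded_clinear f \<Longrightarrow> bounded_clinear g \<Longrightarrow>
    bounded_clinear (\<lambda>x. f x + (g x :: 'b::complex_inner))"
  by (auto simp: bounded_clinear_def scaleC_add_right intro: bounded_linear_add)

lemma bounded_clinear_scaleR:
  "bounded_clinear f \<Longrightarrow> bounded_clinear (\<lambda>x. r *\<^sub>R (f x :: 'b::complex_inner))"
  by (auto simp: bounded_clinear_def scaleC_scaleR_commute
      intro: bounded_linear_compose[OF bounded_linear_scaleR_right])

lemma bounded_clinear_diff:
  "bounded_clinear f \<Longrightarrow> bounded_clinear g \<Longrightarrow>
    bounded_clinear (\<lambda>x. f x - (g x :: 'b::complex_inner))"
  by (auto simp: bounded_clinear_def complex_vector.scale_right_diff_distrib
      intro: bounded_linear_sub)

lemma bounded_clinear_bounded_linear: "bounded_clinear f \<Longrightarrow> bounded_linear f"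
  by (simp add: bounded_clinear_def)

lemma bounded_clinear_scaleC: "bounded_clinear f \<Longrightarrow> f (c *\<^sub>C x) = c *\<^sub>C f x"
  by (simp add: bounded_clinear_def)

lemma
  assumes "bounded_clinear f"
  shows bounded_clinear_plus: "f (x + y) = f x + f y"
    and bounded_clinear_minus: "f (x - y) = f x - f y"
    and bounded_clinear_zero: "f 0 = 0"
    and bounded_clinear_scaleR_arg: "f (r *\<^sub>R x) = r *\<^sub>R f x"
  using assms bounded_clinear_bounded_linear bounded_linear.linear
  by (blast intro: linear_add linear_diff linear_0 linear_scale)+

section \<open>A Riesz lemma for graphs\<close>

text \<open>The first-order condition at the minimum t = 0; it serves both the Riesz argument and
  the kernel of a positive operator.\<close>

lemma linear_le_quadratic_imp_zero:
  fixes a c :: real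
  assumes "\<And>t. 0 \<le> 2 * t * a + t\<^sup>2 * c"
  shows "a = 0"
proof (rule ccontr)
  assume a: "a \<noteq> 0"
  \<comment> \<open>\<open>- a / s\<close> minimises \<open>2 * t * a + t\<^sup>2 * s\<close>; as
    \<open>c\<close> may be nonpositive, a positive number above it takes its place.\<close>
  define s where "s = \<bar>c\<bar> + 1"
  have s: "s > 0" "c < s" by (auto simp: s_def)
  have "2 * (- a / s) * a + (- a / s)\<^sup>2 * c = (a\<^sup>2 / s\<^sup>2) * (c - 2 * s)"
    using s by (simp add: field_simps power2_eq_square)
  moreover have "(a\<^sup>2 / s\<^sup>2) * (c - 2 * s) < 0"
    using a s by (intro mult_pos_neg) auto
  ultimately show False
    using assms[of "- a / s"] by linarith
qed

text \<open>Minimise \<open>\<parallel>a\<parallel>\<^sup>2 - 2 r\<close> over \<open>(a, r) \<in> G\<close>: by the parallelogram law a minimising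
  sequence is Cauchy.\<close>

lemma riesz_graph:
  fixes G :: "('a::{real_inner,banach} \<times> real) set"
  assumes G: "subspace G" and bd: "\<And>a r. (a, r) \<in> G \<Longrightarrow> r \<le> K * norm a"
  shows "\<exists>v\<in>closure (fst ` G). \<forall>(a, r)\<in>G. inner a v = r"
proof -
  define J :: "'a \<times> real \<Rightarrow> real" where "J p = (norm (fst p))\<^sup>2 - 2 * snd p" for p
  define I where "I = Inf (J ` G)"
  have G0: "0 \<in> G" using G subspace_0 by blast
  have lower: "- K\<^sup>2 \<le> J p" if "p \<in> G" for p
  proof -
    have "0 \<le> (norm (fst p) - K)\<^sup>2" by simp
    moreover have "snd p \<le> K * norm (fst p)" using bd[of "fst p" "snd p"] that by simp
    ultimately show ?thesis by (simp add: J_def power2_diff mult.commute)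
  qed
  have I: "I \<le> J p" if "p \<in> G" for p
    unfolding I_def using that lower by (intro cInf_lower bdd_belowI2[of _ "- K\<^sup>2"]) auto
  have "\<exists>p\<in>G. J p < I + 1 / (real n + 1)" for n
    using cInf_lessD[of "J ` G" "I + 1 / (real n + 1)"] G0 by (auto simp: I_def)
  then obtain p where pG: "\<And>n. p n \<in> G" and pJ: "\<And>n. J (p n) < I + 1 / (real n + 1)"
    by metis
  define a where "a n = fst (p n)" for n
  have diff: "(norm (a m - a n))\<^sup>2 \<le> 2 / (real m + 1) + 2 / (real n + 1)" for m n
  proof -
    let ?h = "(1/2) *\<^sub>R (p m + p n)"
    have "?h \<in> G" by (intro subspace_scale subspace_add G pG)
    then have "I \<le> J ?h" by (rule I)
    moreover have "(norm (a m - a n))\<^sup>2 = 2 * J (p m) + 2 * J (p n) - 4 * J ?h"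
      unfolding a_def J_def
      by (simp add: power2_norm_eq_inner inner_add inner_diff
          inner_commute[of "fst (p n)" "fst (p m)"] algebra_simps)
    ultimately show ?thesis using pJ[of m] pJ[of n] by simp
  qed
  have "Cauchy a"
  proof (rule CauchyI)
    fix e :: real assume e: "e > 0"
    obtain N where N: "4 / e\<^sup>2 < real N" using reals_Archimedean2 by blast
    have "norm (a m - a n) < e" if "m \<ge> N" "n \<ge> N" for m n
    proof -
      have N0: "real N > 0" using N by (rule le_less_trans[rotated]) simp
      have "2 / (real m + 1) \<le> 2 / real N" "2 / (real n + 1) \<le> 2 / real N"
        using that N0 by (auto intro!: divide_left_mono)
      then have "(norm (a m - a n))\<^sup>2 \<le> 4 / real N" using diff[of m n] by simp
      also have "\<dots> < e\<^sup>2" using N N0 e by (simp add: field_simps)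
      finally show ?thesis by (rule power2_less_imp_less) (use e in simp)
    qed
    then show "\<exists>M. \<forall>m\<ge>M. \<forall>n\<ge>M. norm (a m - a n) < e" by blast
  qed
  then obtain v where v: "a \<longlonglongrightarrow> v" by (auto simp: Cauchy_convergent_iff convergent_def)
  have "v \<in> closure (fst ` G)"
    using pG v by (auto simp: closure_sequential a_def intro!: exI[of _ a])
  moreover have "inner b v = r" if bG: "(b, r) \<in> G" for b r
  proof -
    \<comment> \<open>First variation of \<open>J\<close> in the direction \<open>(b, r)\<close>.
      Since \<open>p n\<close> minimises only up to \<open>1 / (real n + 1)\<close>, the exact
      inequality appears in the limit.\<close>
    have "0 \<le> 2 * t * (inner b v - r) + t\<^sup>2 * (norm b)\<^sup>2" for t
    proof (rule LIMSEQ_le)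
      show "(\<lambda>n. - (1 / (real n + 1))) \<longlonglongrightarrow> 0"
        using tendsto_minus[OF LIMSEQ_inverse_real_of_nat] by (simp add: inverse_eq_divide add.commute)
      show "(\<lambda>n. 2 * t * (inner b (a n) - r) + t\<^sup>2 * (norm b)\<^sup>2)
          \<longlonglongrightarrow> 2 * t * (inner b v - r) + t\<^sup>2 * (norm b)\<^sup>2"
        by (intro tendsto_intros v)
      have "- (1 / (real n + 1)) \<le> 2 * t * (inner b (a n) - r) + t\<^sup>2 * (norm b)\<^sup>2" for n
      proof -
        have "p n + t *\<^sub>R (b, r) \<in> G" by (intro subspace_scale subspace_add G pG bG)
        then have "I \<le> J (p n + t *\<^sub>R (b, r))" by (rule I)
        moreover have "J (p n + t *\<^sub>R (b, r)) - J (p n)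
            = 2 * t * (inner b (a n) - r) + t\<^sup>2 * (norm b)\<^sup>2"
          unfolding a_def J_def
          by (simp add: power2_norm_eq_inner inner_add inner_commute[of "fst (p n)" b] algebra_simps)
            (simp add: power2_eq_square)
        ultimately show ?thesis using pJ[of n] by simp
      qed
      then show "\<exists>N. \<forall>n\<ge>N. - (1 / (real n + 1)) \<le> 2 * t * (inner b (a n) - r) + t\<^sup>2 * (norm b)\<^sup>2"
        by blast
    qed
    from linear_le_quadratic_imp_zero[OF this] show ?thesis by simp
  qed
  ultimately show ?thesis by (intro bexI[of _ v]) auto
qed

section \<open>Orthogonality and closures of subspaces\<close>

lemma subspace_closure:
  fixes X :: "'a::real_normed_vector set"
  assumes "subspace X"
  shows "subspace (closure X)"
proof (rule subspaceI)
  show "0 \<in> closure X"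
    using assms closure_subset subspace_0 by blast
next
  fix x y assume "x \<in> closure X" "y \<in> closure X"
  then obtain s u where "\<And>n. s n \<in> X" "s \<longlonglongrightarrow> x" "\<And>n. u n \<in> X" "u \<longlonglongrightarrow> y"
    by (auto simp: closure_sequential)
  then show "x + y \<in> closure X"
    unfolding closure_sequential using assms
    by (intro exI[of _ "\<lambda>n. s n + u n"]) (auto intro: tendsto_add subspace_add)
next
  fix c x assume "x \<in> closure X"
  then obtain s where "\<And>n. s n \<in> X" "s \<longlonglongrightarrow> x"
    by (auto simp: closure_sequential)
  then show "c *\<^sub>R x \<in> closure X"
    unfolding closure_sequential using assms
    by (intro exI[of _ "\<lambda>n. c *\<^sub>R s n"]) (auto intro: tendsto_scaleR subspace_scale)
qed

lemma orthogonal_closure: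
  fixes w :: "'a::real_inner"
  assumes "\<And>a. a \<in> X \<Longrightarrow> inner a w = 0" and "a \<in> closure X"
  shows "inner a w = 0"
proof -
  obtain s where s: "\<And>n. s n \<in> X" "s \<longlonglongrightarrow> a"
    using assms(2) by (auto simp: closure_sequential)
  have "(\<lambda>n. inner (s n) w) \<longlonglongrightarrow> inner a w"
    by (intro tendsto_intros s)
  then show ?thesis
    using s assms(1) by (simp add: LIMSEQ_const_iff)
qed

text \<open>The difference lies in the closure and is orthogonal to it, hence to itself. This makes
  Riesz representatives in the closure unique.\<close>

lemma closure_eqI:
  fixes u v :: "'a::real_inner"
  assumes "subspace X" and "u \<in> closure X" and "v \<in> closure X"
    and "\<And>a. a \<in> X \<Longrightarrow> inner a u = inner a v"
  shows "u = v"
proof -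
  have "u - v \<in> closure X"
    using assms(1-3) by (intro subspace_diff subspace_closure)
  then have "inner (u - v) (u - v) = 0"
    using assms(4) orthogonal_closure[of X "u - v" "u - v"] by (simp add: inner_diff_right)
  then show ?thesis by simp
qed

text \<open>If \<open>G\<close> is the graph of a bounded operator defined on a subspace, then \<open>W\<close> is the adjoint
  of the extension of this operator by \<open>0\<close> to the orthogonal complement.\<close>

lemma graph_adjoint:
  fixes G :: "('a::chilbert_space \<times> 'b::chilbert_space) set"
  assumes G: "subspace G"
    and sc: "\<And>a b c. (a, b) \<in> G \<Longrightarrow> (c *\<^sub>C a, c *\<^sub>C b) \<in> G"
    and bd: "\<And>a b. (a, b) \<in> G \<Longrightarrow> norm b \<le> K * norm a"
  shows "\<exists>W. bounded_clinear W \<and> (\<forall>y. W y \<in> closure (fst ` G)) \<and>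
    (\<forall>(a, b)\<in>G. \<forall>y. cinner a (W y) = cinner b y)"
proof -
  have ex: "\<exists>v\<in>closure (fst ` G). \<forall>(a, b)\<in>G. inner a v = inner b y" for y
  proof -
    let ?f = "\<lambda>p::'a \<times> 'b. (fst p, inner (snd p) y)"
    have "linear ?f"
      by (rule linearI) (auto simp: inner_add_left)
    then have sub: "subspace (?f ` G)"
      by (rule linear_subspace_image[OF _ G])
    have "r \<le> (K * norm y) * norm a" if ar: "(a, r) \<in> ?f ` G" for a r
    proof -
      obtain b where b: "(a, b) \<in> G" "r = inner b y" using ar by auto
      have "r \<le> norm b * norm y" using b norm_cauchy_schwarz by metis
      also have "\<dots> \<le> (K * norm a) * norm y" using b bd by (intro mult_right_mono) auto
      finally show ?thesis by (simp add: ac_simps)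
    qed
    from riesz_graph[OF sub this] obtain v where
      v: "v \<in> closure (fst ` ?f ` G)" "\<forall>(a, r)\<in>?f ` G. inner a v = r" by blast
    then have "v \<in> closure (fst ` G)" "\<And>a b. (a, b) \<in> G \<Longrightarrow> inner a v = inner b y"
      by (auto simp: image_image)
    then show ?thesis by blast
  qed
  define W where "W y = (SOME v. v \<in> closure (fst ` G) \<and> (\<forall>(a, b)\<in>G. inner a v = inner b y))" for y
  have W_some: "W y \<in> closure (fst ` G) \<and> (\<forall>(a, b)\<in>G. inner a (W y) = inner b y)" for y
    unfolding W_def by (rule someI_ex) (use ex[of y] in blast)
  have WG: "\<And>y. W y \<in> closure (fst ` G)"
    and W: "\<And>a b y. (a, b) \<in> G \<Longrightarrow> inner a (W y) = inner b y"
    using W_some by auto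
  have M: "subspace (fst ` G)"
    by (rule linear_subspace_image[OF _ G]) (simp add: linear_fst)
  \<comment> \<open>Uniqueness within the closure turns the pointwise chosen representatives into a
    linear map.\<close>
  have eqI: "W y = v" if "v \<in> closure (fst ` G)" "\<And>a b. (a, b) \<in> G \<Longrightarrow> inner a v = inner b y" for y v
    using that W by (intro closure_eqI[OF M WG]) force+
  have add: "W (x + y) = W x + W y" for x y
    using W WG subspace_closure[OF M] by (intro eqI) (auto simp: inner_add_right intro: subspace_add)
  have scW: "W (c *\<^sub>C x) = c *\<^sub>C W x" for c x
  proof (rule eqI)
    have "(\<lambda>x. c *\<^sub>C x) ` closure (fst ` G) \<subseteq> closure ((\<lambda>x. c *\<^sub>C x) ` fst ` G)"
      by (intro closure_bounded_linear_image_subset bounded_linear_scaleC)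
    also have "\<dots> \<subseteq> closure (fst ` G)"
      using sc by (intro closure_mono) force
    finally show "c *\<^sub>C W x \<in> closure (fst ` G)" using WG by blast
    show "inner a (c *\<^sub>C W x) = inner b (c *\<^sub>C x)" if "(a, b) \<in> G" for a b
      using W[OF sc[OF that]] by (metis inner_scaleC_left complex_cnj_cnj)
  qed
  have bound: "norm (W y) \<le> norm y * \<bar>K\<bar>" for y
  proof -
    \<comment> \<open>To be used with a = W y, which lies only in the closure of the domain; hence
      the passage to the limit.\<close>
    have "inner a (W y) \<le> (\<bar>K\<bar> * norm y) * norm a" if a: "a \<in> closure (fst ` G)" for a
    proof -
      obtain s where s: "\<And>n. s n \<in> fst ` G" "s \<longlonglongrightarrow> a"
        using a by (auto simp: closure_sequential)
      have "inner (s n) (W y) \<le> (\<bar>K\<bar> * norm y) * norm (s n)" for n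
      proof -
        obtain b where b: "(s n, b) \<in> G" using s(1)[of n] by force
        have "inner (s n) (W y) \<le> norm b * norm y" 
          using W[OF b] norm_cauchy_schwarz by metis
        also have "\<dots> \<le> (\<bar>K\<bar> * norm (s n)) * norm y"
          using bd[OF b] mult_right_mono[OF abs_ge_self[of K] norm_ge_zero[of "s n"]]
          by (intro mult_right_mono) (linarith, simp)
        finally show ?thesis by (simp add: ac_simps)
      qed
      then show ?thesis
        by (intro LIMSEQ_le[OF tendsto_inner[OF s(2) tendsto_const]
              tendsto_mult_left[OF tendsto_norm[OF s(2)]]]) blast
    qed
    from this[OF WG[of y]] have "norm (W y) * norm (W y) \<le> (\<bar>K\<bar> * norm y) * norm (W y)"
      by (simp add: power2_norm_eq_inner[symmetric] power2_eq_square)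
    then show ?thesis
      by (cases "W y = 0") (auto simp: ac_simps)
  qed
  have "bounded_clinear W"
    unfolding bounded_clinear_def using add scW bound
    by (auto intro!: bounded_linear_intro[where K = "\<bar>K\<bar>"] simp: scaleR_scaleC)
  moreover have "cinner a (W y) = cinner b y" if "(a, b) \<in> G" for a b y
    using W[OF that] W[OF sc[OF that]] by (rule cinner_eqI)
  ultimately show ?thesis using WG by blast
qed

text \<open>The bound makes \<open>A x\<close> \<mapsto> \<open>B x\<close> a bounded map on the
  range of \<open>A\<close>, and \<open>W\<close> is the adjoint of its extension by 0. With the
  identity for \<open>A\<close> this yields adjoints, with A = B positive the projection onto the
  closed range, and with A = |T|, B = T the adjoint of the polar factor.\<close>

lemma range_adjoint:
  fixes A :: "'a::complex_inner \<Rightarrow> 'b::chilbert_space" and B :: "'a \<Rightarrow> 'c::chilbert_space"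
  assumes A: "bounded_clinear A" and B: "bounded_clinear B"
    and bd: "\<And>x. norm (B x) \<le> K * norm (A x)"
  shows "\<exists>W. bounded_clinear W \<and> (\<forall>y. W y \<in> closure (range A)) \<and>
    (\<forall>x y. cinner (A x) (W y) = cinner (B x) y)"
proof -
  let ?G = "range (\<lambda>x. (A x, B x))"
  have G: "subspace (range (\<lambda>x. (A x, B x)))"
    by (rule linear_subspace_image[OF linearI subspace_UNIV])
      (simp_all add: bounded_clinear_plus bounded_clinear_scaleR_arg A B)
  have sc: "(c *\<^sub>C a, c *\<^sub>C b) \<in> range (\<lambda>x. (A x, B x))"
    if ab: "(a, b) \<in> range (\<lambda>x. (A x, B x))" for a b c
  proof -
    obtain x where "a = A x" "b = B x" using ab by (elim rangeE) simp
    then show ?thesis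
      by (intro range_eqI[of _ _ "c *\<^sub>C x"])
        (simp add: bounded_clinear_scaleC[OF A] bounded_clinear_scaleC[OF B])
  qed
  have bdG: "norm b \<le> K * norm a" if "(a, b) \<in> ?G" for a b
    using that bd by auto
  from graph_adjoint[OF G sc bdG] obtain W where "bounded_clinear W"
    "\<forall>y. W y \<in> closure (fst ` ?G)" "\<forall>(a, b)\<in>?G. \<forall>y. cinner a (W y) = cinner b y"
    by blast
  moreover have "fst ` ?G = range A" by (simp add: image_image)
  ultimately show ?thesis by (intro exI[of _ W]) simp
qed

section \<open>Adjoints\<close>

lemma
  fixes T :: "'a::chilbert_space \<Rightarrow> 'b::chilbert_space"
  assumes T: "bounded_clinear T"
  shows bounded_clinear_cadjoint: "bounded_clinear (cadjoint T)"
    and cinner_cadjoint: "cinner (T x) y = cinner x (cadjoint T y)"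
proof -
  obtain K where K: "\<And>x. norm (T x) \<le> norm x * K"
    using bounded_linear.bounded[OF bounded_clinear_bounded_linear[OF T]] by blast
  have "norm (T x) \<le> K * norm (id x)" for x
    using K[of x] by (simp add: mult.commute)
  from range_adjoint[OF bounded_clinear_id T this] obtain W where
    W: "bounded_clinear W" "\<forall>x y. cinner (id x) (W y) = cinner (T x) y" by blast
  have "\<exists>!T'. bounded_clinear T' \<and> (\<forall>x y. cinner (T x) y = cinner x (T' y))"
  proof (rule ex1I[of _ W])
    fix T' assume T': "bounded_clinear T' \<and> (\<forall>x y. cinner (T x) y = cinner x (T' y))"
    show "T' = W"
      by (rule ext, rule cinner_ext) (use T' W in simp)
  qed (use W in simp)
  from theI'[OF this, folded cadjoint_def]
  show "bounded_clinear (cadjoint T)" "cinner (T x) y = cinner x (cadjoint T y)"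
    by blast+
qed

lemma cadjoint_eqI:
  assumes "bounded_clinear T" and "\<And>x y. cinner (T x) y = cinner x (T' y)"
  shows "cadjoint T = T'"
proof (rule ext, rule cinner_ext)
  show "cinner x (cadjoint T y) = cinner x (T' y)" for x y
    by (rule trans[OF cinner_cadjoint[OF assms(1), symmetric] assms(2)])
qed

lemma cadjoint_cadjoint:
  assumes "bounded_clinear T"
  shows "cadjoint (cadjoint T) = T"
proof (rule cadjoint_eqI)
  show "bounded_clinear (cadjoint T)"
    using assms by (rule bounded_clinear_cadjoint)
  show "cinner (cadjoint T x) y = cinner x (T y)" for x y
    using cinner_cadjoint[OF assms, of y x] cinner_commute[of "cadjoint T x" y]
      cinner_commute[of x "T y"] by simp
qed

lemma inner_cadjoint:
  "bounded_clinear T \<Longrightarrow> inner (T x) y = inner x (cadjoint T y)"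
  by (simp add: inner_eq_Re_cinner cinner_cadjoint)

section \<open>Square roots\<close>

text \<open>The iteration converges in norm to the solution \<open>X\<close> of \<open>X = (C + X\<^sup>2) / 2\<close>, that is,
  \<open>(1 - X)\<^sup>2 = 1 - C\<close>. The same iteration with \<open>C = 1\<close> is a scalar majorant.\<close>

primrec sqrt_iter :: "('a::real_normed_vector \<Rightarrow>\<^sub>L 'a) \<Rightarrow> nat \<Rightarrow> 'a \<Rightarrow>\<^sub>L 'a" where
  "sqrt_iter C 0 = 0"
| "sqrt_iter C (Suc n) = (1/2) *\<^sub>R (C + (sqrt_iter C n o\<^sub>L sqrt_iter C n))"

primrec sqrt_majorant :: "nat \<Rightarrow> real" where
  "sqrt_majorant 0 = 0"
| "sqrt_majorant (Suc n) = (1 + (sqrt_majorant n)\<^sup>2) / 2"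

lemma sqrt_majorant_bounds: "0 \<le> sqrt_majorant n \<and> sqrt_majorant n \<le> 1"
  by (induction n) (auto simp: power_le_one)

lemma incseq_sqrt_majorant: "incseq sqrt_majorant"
proof (rule incseq_SucI)
  show "sqrt_majorant n \<le> sqrt_majorant (Suc n)" for n
    using zero_le_power2[of "1 - sqrt_majorant n"] by (simp add: power2_diff)
qed

lemma norm_sqrt_iter:
  assumes "norm C \<le> 1"
  shows "norm (sqrt_iter C n) \<le> sqrt_majorant n"
proof (induction n)
  case (Suc n)
  have "norm (sqrt_iter C n o\<^sub>L sqrt_iter C n) \<le> norm (sqrt_iter C n) * norm (sqrt_iter C n)"
    by (rule norm_blinfun_compose)
  also have "\<dots> \<le> (sqrt_majorant n)\<^sup>2"
    unfolding power2_eq_square using sqrt_majorant_bounds[of n] by (intro mult_mono Suc) auto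
  finally have "norm (C + (sqrt_iter C n o\<^sub>L sqrt_iter C n)) \<le> 1 + (sqrt_majorant n)\<^sup>2"
    using assms norm_triangle_ineq[of C "sqrt_iter C n o\<^sub>L sqrt_iter C n"] by linarith
  then show ?case by simp
qed simp

text \<open>The increments of the majorant telescope to a bounded sum, so domination gives absolute
  convergence even when \<open>norm C\<close> is 1, where the iteration need not be a
  contraction.\<close>

lemma norm_sqrt_iter_diff:
  assumes "norm C \<le> 1"
  shows "norm (sqrt_iter C (Suc n) - sqrt_iter C n) \<le> sqrt_majorant (Suc n) - sqrt_majorant n"
proof (induction n)
  case 0
  then show ?case using assms by simp
next
  case (Suc n)
  let ?B = "sqrt_iter C (Suc n)" and ?B' = "sqrt_iter C n"
  let ?b = "sqrt_majorant (Suc n)" and ?b' = "sqrt_majorant n"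
  have "sqrt_iter C (Suc (Suc n)) - ?B = (1/2) *\<^sub>R ((C + (?B o\<^sub>L ?B)) - (C + (?B' o\<^sub>L ?B')))"
    by (simp only: sqrt_iter.simps scaleR_diff_right)
  \<comment> \<open>A difference of squares without commutativity; each summand has one majorised
    factor and one increment.\<close>
  also have "(C + (?B o\<^sub>L ?B)) - (C + (?B' o\<^sub>L ?B')) = (?B o\<^sub>L (?B - ?B')) + ((?B - ?B') o\<^sub>L ?B')"
    by (simp only: bounded_bilinear.diff_right[OF bounded_bilinear_blinfun_compose]
        bounded_bilinear.diff_left[OF bounded_bilinear_blinfun_compose]) simp
  finally have "norm (sqrt_iter C (Suc (Suc n)) - ?B)
      \<le> (1/2) * (norm (?B o\<^sub>L (?B - ?B')) + norm ((?B - ?B') o\<^sub>L ?B'))"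
    by (simp del: sqrt_iter.simps add: norm_triangle_ineq)
  also have "\<dots> \<le> (1/2) * (?b * (?b - ?b') + (?b - ?b') * ?b')"
  proof -
    have "norm (?B o\<^sub>L (?B - ?B')) \<le> ?b * (?b - ?b')"
      using sqrt_majorant_bounds[of "Suc n"]
      by (intro order_trans[OF norm_blinfun_compose] mult_mono norm_sqrt_iter assms Suc) 
        (auto simp del: sqrt_majorant.simps)
    moreover have "norm ((?B - ?B') o\<^sub>L ?B') \<le> (?b - ?b') * ?b'"
      using incseq_SucD[OF incseq_sqrt_majorant, of n]
      by (intro order_trans[OF norm_blinfun_compose] mult_mono norm_sqrt_iter assms Suc)
        (auto simp del: sqrt_majorant.simps)
    ultimately show ?thesis by (intro mult_left_mono add_mono) auto
  qed
  also have "\<dots> = sqrt_majorant (Suc (Suc n)) - ?b"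
  proof -
    have "a - b = (1/2) * (b * (b - c) + (b - c) * c)"
      if "a = (1 + b\<^sup>2) / 2" "b = (1 + c\<^sup>2) / 2" for a b c :: real
    proof -
      have "2 * a = 1 + b * b" using that(1) by (simp add: power2_eq_square)
      moreover have "2 * b = 1 + c * c" using that(2) by (simp add: power2_eq_square)
      ultimately show ?thesis by (simp add: algebra_simps)
    qed
    from this[OF sqrt_majorant.simps(2) sqrt_majorant.simps(2)] show ?thesis by (rule sym)
  qed
  finally show ?case .
qed

lemma convergent_sqrt_iter:
  fixes C :: "'a::{real_normed_vector,banach} \<Rightarrow>\<^sub>L 'a"
  assumes "norm C \<le> 1"
  shows "convergent (sqrt_iter C)"
proof -
  have "Bseq sqrt_majorant"
    using sqrt_majorant_bounds by (intro BseqI'[of _ 1]) auto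
  then have "convergent sqrt_majorant"
    using incseq_sqrt_majorant by (intro Bseq_mono_convergent) (auto simp: incseq_def)
  then have "summable (\<lambda>n. sqrt_majorant (Suc n) - sqrt_majorant n)"
    unfolding convergent_def using telescope_summable by blast
  then have "summable (\<lambda>n. sqrt_iter C (Suc n) - sqrt_iter C n)"
    by (rule summable_comparison_test') (rule norm_sqrt_iter_diff[OF assms])
  then show ?thesis
    by (simp add: summable_iff_convergent sum_lessThan_telescope del: sqrt_iter.simps(2))
qed

lemma sqrt_iter_commute:
  fixes C :: "'a::real_normed_vector \<Rightarrow>\<^sub>L 'a"
  assumes "bounded_linear D" and "\<And>x. C (D x) = D (C x)"
  shows "sqrt_iter C n (D x) = D (sqrt_iter C n x)"
proof (induction n arbitrary: x)
  case 0
  then show ?case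
    using assms(1) by (simp add: linear_simps)
next
  case (Suc n)
  then show ?case
    using assms by (simp add: linear_simps blinfun.add_left blinfun.scaleR_left)
qed

lemma sqrt_iter_selfadjoint:
  fixes C :: "'a::real_inner \<Rightarrow>\<^sub>L 'a"
  assumes "\<And>x y. inner (C x) y = inner x (C y)"
  shows "inner (sqrt_iter C n x) y = inner x (sqrt_iter C n y)"
  using assms
  by (induction n arbitrary: x y)
    (auto simp: blinfun.add_left blinfun.scaleR_left inner_add)

text \<open>\<open>D\<close> ranges over all real-linear bounded operators. This covers complex
  scalings, which give complex linearity of the limit, rival square roots, which give uniqueness,
  and T itself, which gives the quasinormality criterion.\<close>

definition in_bicommutant :: "('a::real_normed_vector \<Rightarrow> 'a) \<Rightarrow> ('a \<Rightarrow> 'a) \<Rightarrow> bool" where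
  "in_bicommutant C X \<longleftrightarrow>
    (\<forall>D. bounded_linear D \<longrightarrow> (\<forall>x. C (D x) = D (C x)) \<longrightarrow> (\<forall>x. X (D x) = D (X x)))"

lemma in_bicommutantD:
  "in_bicommutant C X \<Longrightarrow> bounded_linear D \<Longrightarrow> (\<And>x. C (D x) = D (C x)) \<Longrightarrow> X (D x) = D (X x)"
  unfolding in_bicommutant_def by blast

lemma in_bicommutantI:
  "(\<And>D x. bounded_linear D \<Longrightarrow> (\<And>x. C (D x) = D (C x)) \<Longrightarrow> X (D x) = D (X x)) \<Longrightarrow> in_bicommutant C X"
  unfolding in_bicommutant_def by blast

text \<open>\<open>X\<close> is 1 minus the square root of 1 - C, the operator-norm limit of the
  iteration. A limit in \<open>\<Rightarrow>\<^sub>L\<close> is only known to be real-linear; the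
  bicommutant property later supplies complex linearity.\<close>

lemma ex_one_minus_sqrt:
  fixes C :: "'a::{real_inner,banach} \<Rightarrow> 'a"
  assumes C: "bounded_linear C" and C1: "\<And>x. norm (C x) \<le> norm x"
    and self: "\<And>x y. inner (C x) y = inner x (C y)"
  obtains X where "bounded_linear X" "\<And>x. norm (X x) \<le> norm x"
    "\<And>x y. inner (X x) y = inner x (X y)" "\<And>x. 2 *\<^sub>R X x = C x + X (X x)"
    "in_bicommutant C X"
proof -
  define C' where "C' = Blinfun C"
  have C': "blinfun_apply C' = C"
    unfolding C'_def using C by (rule bounded_linear_Blinfun_apply)
  have nC: "norm C' \<le> 1"
    by (rule norm_blinfun_bound) (simp_all add: C' C1)
  obtain X where X: "sqrt_iter C' \<longlonglongrightarrow> X"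
    using convergent_sqrt_iter[OF nC] by (auto simp: convergent_def)
  have Xx: "(\<lambda>n. sqrt_iter C' n x) \<longlonglongrightarrow> X x" for x
    by (intro tendsto_intros X)
  have "(\<lambda>n. sqrt_iter C' (Suc n)) \<longlonglongrightarrow> (1/2) *\<^sub>R (C' + (X o\<^sub>L X))"
    unfolding sqrt_iter.simps
    by (intro tendsto_intros X bounded_bilinear.tendsto[OF bounded_bilinear_blinfun_compose])
  then have eq: "X = (1/2) *\<^sub>R (C' + (X o\<^sub>L X))"
    using X LIMSEQ_Suc LIMSEQ_unique by blast
  have X_eq: "2 *\<^sub>R X x = C x + X (X x)" for x
    by (subst (1) eq) (simp add: blinfun.add_left blinfun.scaleR_left C')
  have X_norm: "norm (X x) \<le> norm x" for x
  proof -
    have "norm (sqrt_iter C' n) \<le> 1" for n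
      using norm_sqrt_iter[OF nC, of n] sqrt_majorant_bounds[of n] by linarith
    then have "norm X \<le> 1"
      by (intro Lim_norm_ubound[OF _ X]) auto
    then show ?thesis
      using norm_blinfun[of X x] mult_right_mono[of "norm X" 1 "norm x"] by simp
  qed
  have X_self: "inner (X x) y = inner x (X y)" for x y
  proof (rule LIMSEQ_unique)
    show "(\<lambda>n. inner (sqrt_iter C' n x) y) \<longlonglongrightarrow> inner (X x) y"
      by (intro tendsto_intros Xx)
    have "(\<lambda>n. inner x (sqrt_iter C' n y)) \<longlonglongrightarrow> inner x (X y)"
      by (intro tendsto_intros Xx)
    then show "(\<lambda>n. inner (sqrt_iter C' n x) y) \<longlonglongrightarrow> inner x (X y)"
      by (subst sqrt_iter_selfadjoint) (simp_all add: C' self)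
  qed
  have "X (D x) = D (X x)"
    if D: "bounded_linear D" and CD: "\<And>x. C (D x) = D (C x)" for D x
  proof (rule LIMSEQ_unique)
    show "(\<lambda>n. sqrt_iter C' n (D x)) \<longlonglongrightarrow> X (D x)"
      by (rule Xx)
    have "(\<lambda>n. D (sqrt_iter C' n x)) \<longlonglongrightarrow> D (X x)"
      by (intro bounded_linear.tendsto[OF D] Xx)
    then show "(\<lambda>n. sqrt_iter C' n (D x)) \<longlonglongrightarrow> D (X x)"
      by (subst sqrt_iter_commute[OF D]) (simp_all add: C' CD)
  qed
  then have X_bi: "in_bicommutant C X"
    by (rule in_bicommutantI)
  show thesis
    by (rule that[of "blinfun_apply X"]) (fact X_eq X_norm X_self X_bi blinfun.bounded_linear_right)+
qed

section \<open>Positive operators and uniqueness of commuting square roots\<close>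

lemma positive_opI:
  assumes P: "bounded_clinear P" and self: "\<And>x y. inner (P x) y = inner x (P y)"
    and pos: "\<And>x. 0 \<le> inner x (P x)"
  shows "positive_op P"
proof -
  \<comment> \<open>Moving \<open>\<i>\<close> across the real-symmetric \<open>P\<close> reverses
    the sign, so the quadratic form is real.\<close>
  have "inner (\<i> *\<^sub>C x) (P x) = 0" for x
  proof -
    have "inner (\<i> *\<^sub>C x) (P x) = inner (P (\<i> *\<^sub>C x)) x"
      by (rule self[symmetric])
    also have "\<dots> = inner (\<i> *\<^sub>C P x) x"
      by (simp only: bounded_clinear_scaleC[OF P])
    also have "\<dots> = inner (P x) (cnj \<i> *\<^sub>C x)"
      by (rule inner_scaleC_left)
    also have "\<dots> = - inner (\<i> *\<^sub>C x) (P x)"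
      by (simp add: inner_commute)
    finally show ?thesis by simp
  qed
  then have "cinner x (P x) \<in> \<real>\<^sub>\<ge>\<^sub>0" for x
    using pos[of x] by (simp add: complex_nonneg_Reals_iff Im_cinner inner_eq_Re_cinner)
  with P show ?thesis by (simp add: positive_op_def)
qed

lemma positive_op_bounded_clinear: "positive_op P \<Longrightarrow> bounded_clinear P"
  by (simp add: positive_op_def)

lemma positive_op_inner_nonneg: "positive_op P \<Longrightarrow> 0 \<le> inner x (P x)"
  by (simp add: positive_op_def complex_nonneg_Reals_iff inner_eq_Re_cinner)

lemma positive_op_inner:
  assumes P: "positive_op P"
  shows "inner (P x) y = inner x (P y)"
proof -
  note lin = bounded_clinear_plus[OF positive_op_bounded_clinear[OF P]]
    bounded_clinear_scaleC[OF positive_op_bounded_clinear[OF P]]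
  have im: "Im (cinner z (P z)) = 0" for z
    using P by (simp add: positive_op_def complex_nonneg_Reals_iff)
  \<comment> \<open>Polarisation at this single vector suffices: the imaginary part of the mixed
    terms is exactly the difference of the two real products.\<close>
  have "Im (cinner (x + \<i> *\<^sub>C y) (P (x + \<i> *\<^sub>C y))) = 0"
    by (rule im)
  then have "Re (cinner x (P y)) = Re (cinner y (P x))"
    using im[of x] im[of y]
    by (simp add: lin cinner_add_left cinner_add_right cinner_scaleC_left cinner_scaleC_right)
  then show ?thesis
    by (simp add: inner_eq_Re_cinner[symmetric] inner_commute)
qed

lemma positive_op_cinner:
  assumes P: "positive_op P"
  shows "cinner (P x) y = cinner x (P y)"
proof (rule cinner_eqI)
  show "inner (P x) y = inner x (P y)"
    by (rule positive_op_inner[OF P])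
  show "inner (\<i> *\<^sub>C P x) y = inner (\<i> *\<^sub>C x) (P y)"
    using positive_op_inner[OF P, of "\<i> *\<^sub>C x" y]
    by (simp add: bounded_clinear_scaleC[OF positive_op_bounded_clinear[OF P]])
qed

lemma positive_op_cadjoint:
  assumes P: "positive_op P"
  shows "cadjoint P = P"
  by (rule cadjoint_eqI[OF positive_op_bounded_clinear[OF P] positive_op_cinner[OF P]])

text \<open>On the line through x in direction P x the form is a nonnegative quadratic without
  constant term, so its linear coefficient, twice the squared norm of P x, vanishes.\<close>

lemma positive_op_kernel:
  assumes P: "positive_op P" and 0: "inner x (P x) = 0"
  shows "P x = 0"
proof -
  note lin = bounded_clinear_plus[OF positive_op_bounded_clinear[OF P]]
    bounded_clinear_scaleR_arg[OF positive_op_bounded_clinear[OF P]]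
  have "0 \<le> 2 * t * inner (P x) (P x) + t\<^sup>2 * inner (P x) (P (P x))" for t
  proof -
    have "0 \<le> inner (x + t *\<^sub>R P x) (P (x + t *\<^sub>R P x))"
      by (rule positive_op_inner_nonneg[OF P])
    also have "\<dots> = 2 * t * inner (P x) (P x) + t\<^sup>2 * inner (P x) (P (P x))"
      using positive_op_inner[OF P, of x "P x"] 0
      by (simp add: lin inner_add power2_eq_square algebra_simps)
    finally show ?thesis .
  qed
  from linear_le_quadratic_imp_zero[OF this] show ?thesis by simp
qed

text \<open>By commutation (P + Q)(P - Q) = 0. Positivity splits this into Py = Qy = 0 for y = (P -
  Q) x, and then the squared norm of y is the product of x with (P - Q) y, which is 0.\<close>

lemma positive_sqrt_unique:
  assumes P: "positive_op P" and Q: "positive_op Q"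
    and comm: "\<And>x. P (Q x) = Q (P x)" and eq: "\<And>x. P (P x) = Q (Q x)"
  shows "P = Q"
proof
  fix x
  note linP = bounded_clinear_minus[OF positive_op_bounded_clinear[OF P]]
  note linQ = bounded_clinear_minus[OF positive_op_bounded_clinear[OF Q]]
  define y where "y = P x - Q x"
  have "P y + Q y = 0"
    by (simp add: y_def linP linQ comm eq)
  then have "inner y (P y) + inner y (Q y) = 0"
    by (metis inner_add_right inner_zero_right)
  then have "P y = 0" "Q y = 0"
    using positive_op_inner_nonneg[OF P, of y] positive_op_inner_nonneg[OF Q, of y]
    by (intro positive_op_kernel[OF P] positive_op_kernel[OF Q]; linarith)+
  have "inner y y = inner x (P y - Q y)"
    by (simp add: y_def linP linQ inner_diff positive_op_inner[OF P] positive_op_inner[OF Q])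
  then have "y = 0"
    using \<open>P y = 0\<close> \<open>Q y = 0\<close> by simp
  then show "P x = Q x"
    by (simp add: y_def)
qed

section \<open>Existence of complex-linear positive square roots\<close>

lemma ex_one_minus_sqrt_clinear:
  fixes C :: "'a::chilbert_space \<Rightarrow> 'a"
  assumes C: "bounded_clinear C" and C1: "\<And>x. norm (C x) \<le> norm x"
    and self: "\<And>x y. inner (C x) y = inner x (C y)"
  obtains X where "bounded_clinear X" "\<And>x. norm (X x) \<le> norm x"
    "\<And>x y. inner (X x) y = inner x (X y)" "positive_op (\<lambda>x. x - X x)"
    "\<And>x. (x - X x) - X (x - X x) = x - C x"
    "in_bicommutant C X"
proof -
  obtain X where X: "bounded_linear X" "\<And>x. norm (X x) \<le> norm x"
    "\<And>x y. inner (X x) y = inner x (X y)" "\<And>x. 2 *\<^sub>R X x = C x + X (X x)"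
    "in_bicommutant C X"
    by (rule ex_one_minus_sqrt[OF bounded_clinear_bounded_linear[OF C] C1 self]) (rule that)
  \<comment> \<open>Scaling by \<open>c\<close> commutes with \<open>C\<close>, hence with the limit
    \<open>X\<close>.\<close>
  have "X (c *\<^sub>C x) = c *\<^sub>C X x" for c x
    using in_bicommutantD[OF X(5) bounded_linear_scaleC, of c x]
    by (simp add: bounded_clinear_scaleC[OF C])
  with X(1) have cX: "bounded_clinear X"
    unfolding bounded_clinear_def by blast
  have "0 \<le> inner x (x - X x)" for x
  proof -
    have "inner x (X x) \<le> norm x * norm (X x)" by (rule norm_cauchy_schwarz)
    also have "\<dots> \<le> norm x * norm x" by (intro mult_left_mono X(2)) simp
    finally show ?thesis by (simp add: inner_diff_right power2_norm_eq_inner[symmetric] power2_eq_square)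
  qed
  moreover have "bounded_clinear (\<lambda>x. x - X x)"
    using bounded_clinear_diff[OF bounded_clinear_id cX] by simp
  ultimately have pos: "positive_op (\<lambda>x. x - X x)"
    by (intro positive_opI) (simp_all add: inner_diff X(3))
  have sq: "(x - X x) - X (x - X x) = x - C x" for x
  proof -
    have "C x = X x + X x - X (X x)"
      using X(4)[of x] by (simp only: scaleR_2 eq_diff_eq)
    then show ?thesis by (simp add: bounded_clinear_minus[OF cX] algebra_simps)
  qed
  show thesis
    by (rule that[of X]) (fact cX X pos sq)+
qed

text \<open>Since P = 1 - X and \<open>X\<close> is again a self-adjoint contraction, the same
  construction applied to \<open>X\<close> yields a root \<open>R\<close> of \<open>P\<close>.
  Positivity of tensor products uses this second root.\<close>

lemma ex_positive_sqrt:
  fixes C :: "'a::chilbert_space \<Rightarrow> 'a"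
  assumes "bounded_clinear C" and "\<And>x. norm (C x) \<le> norm x"
    and "\<And>x y. inner (C x) y = inner x (C y)"
  obtains P R where "positive_op P" "\<And>x. P (P x) = x - C x"
    "positive_op R" "\<And>x. R (R x) = P x"
    "in_bicommutant C P"
proof -
  obtain X where X: "bounded_clinear X" "\<And>x. norm (X x) \<le> norm x"
    "\<And>x y. inner (X x) y = inner x (X y)" "positive_op (\<lambda>x. x - X x)"
    "\<And>x. (x - X x) - X (x - X x) = x - C x"
    "in_bicommutant C X"
    by (rule ex_one_minus_sqrt_clinear[OF assms]) (rule that)
  obtain Y where Y: "positive_op (\<lambda>x. x - Y x)" "\<And>x. (x - Y x) - Y (x - Y x) = x - X x"
    by (rule ex_one_minus_sqrt_clinear[OF X(1-3)]) (rule that)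
  show thesis
  proof (rule that[of "\<lambda>x. x - X x" "\<lambda>x. x - Y x"])
    show "in_bicommutant C (\<lambda>x. x - X x)"
    proof (rule in_bicommutantI)
      fix D :: "'a \<Rightarrow> 'a" and x
      assume D: "bounded_linear D" "\<And>x. C (D x) = D (C x)"
      show "D x - X (D x) = D (x - X x)"
        using in_bicommutantD[OF X(6) D, of x] linear_simps(2)[OF D(1), of x "X x"] by simp
    qed
  qed (fact X Y)+
qed

lemma positive_op_scaleR:
  "positive_op P \<Longrightarrow> 0 \<le> r \<Longrightarrow> positive_op (\<lambda>x. r *\<^sub>R P x)"
  by (intro positive_opI bounded_clinear_scaleR)
    (simp_all add: positive_op_bounded_clinear positive_op_inner positive_op_inner_nonneg)

lemma bounded_clinear_pos_bound:
  assumes "bounded_clinear T"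
  obtains K where "0 < K" "\<And>x. norm (T x) \<le> K * norm x"
proof -
  obtain K where "0 < K" "\<And>x. norm (T x) \<le> norm x * K"
    using bounded_linear.pos_bounded[OF bounded_clinear_bounded_linear[OF assms]] by blast
  then show thesis by (intro that[of K]) (simp_all add: mult.commute)
qed

lemma norm_cadjoint_le:
  assumes T: "bounded_clinear T" and K0: "0 \<le> K" and K: "\<And>x. norm (T x) \<le> K * norm x"
  shows "norm (cadjoint T y) \<le> K * norm y"
proof (cases "cadjoint T y = 0")
  case True
  with K0 show ?thesis by simp
next
  case False
  have "norm (cadjoint T y) * norm (cadjoint T y) = inner (T (cadjoint T y)) y"
    by (simp add: inner_cadjoint[OF T] power2_norm_eq_inner[symmetric] power2_eq_square)
  also have "\<dots> \<le> norm (T (cadjoint T y)) * norm y"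
    by (rule norm_cauchy_schwarz)
  also have "\<dots> \<le> (K * norm (cadjoint T y)) * norm y"
    by (intro mult_right_mono K) simp
  finally show ?thesis
    using False by (simp add: ac_simps)
qed

lemma inner_cadjoint_comp:
  assumes T: "bounded_clinear T"
  shows "inner (cadjoint T (T x)) y = inner x (cadjoint T (T y))"
  by (simp only: inner_commute[of "cadjoint T (T x)" y] inner_cadjoint[OF T, symmetric]
      inner_commute[of "T y" "T x"])

text \<open>Divided by the square of a bound K for \<open>T\<close>, the operator
  \<open>cadjoint T \<circ> T\<close> is a self-adjoint contraction C; \<open>R\<close> is K times
  the root of 1 - C.\<close>

lemma ex_sqrt_bound_minus:
  fixes T :: "'a::chilbert_space \<Rightarrow> 'a"
  assumes T: "bounded_clinear T"
  obtains K R where "positive_op R"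
    "\<And>x. R (R x) = (K\<^sup>2) *\<^sub>R x - cadjoint T (T x)"
proof -
  obtain K where K: "0 < K" "\<And>x. norm (T x) \<le> K * norm x"
    by (rule bounded_clinear_pos_bound[OF T]) (rule that)
  define C where "C x = (1 / K\<^sup>2) *\<^sub>R cadjoint T (T x)" for x
  have C: "bounded_clinear C"
    unfolding C_def using bounded_clinear_compose[OF bounded_clinear_cadjoint[OF T] T]
    by (intro bounded_clinear_scaleR) (simp add: o_def)
  have C1: "norm (C x) \<le> norm x" for x
  proof -
    have "norm (cadjoint T (T x)) \<le> K * norm (T x)"
      using K by (intro norm_cadjoint_le T) auto
    also have "\<dots> \<le> K * (K * norm x)"
      using K by (intro mult_left_mono) auto
    finally show ?thesis
      using K(1) by (simp add: C_def divide_simps power2_eq_square ac_simps)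
  qed
  have self: "inner (C x) y = inner x (C y)" for x y
    by (simp add: C_def inner_cadjoint_comp[OF T])
  obtain P where P: "positive_op P" "\<And>x. P (P x) = x - C x"
    by (rule ex_positive_sqrt[OF C C1 self]) (rule that)
  show thesis
  proof (rule that)
    show "positive_op (\<lambda>x. K *\<^sub>R P x)"
      using K by (intro positive_op_scaleR P) simp
    show "K *\<^sub>R P (K *\<^sub>R P x) = (K\<^sup>2) *\<^sub>R x - cadjoint T (T x)" for x
      using K(1) P(2)
      by (simp add: bounded_clinear_scaleR_arg[OF positive_op_bounded_clinear[OF P(1)]] C_def
          scaleR_diff_right power2_eq_square)
  qed
qed

section \<open>The absolute value\<close>

lemma ex_abs_op:
  fixes T :: "'a::chilbert_space \<Rightarrow> 'a"
  assumes T: "bounded_clinear T"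
  obtains P R where "positive_op P" "\<And>x. P (P x) = cadjoint T (T x)"
    "positive_op R" "\<And>x. R (R x) = P x" "in_bicommutant (cadjoint T \<circ> T) P"
proof -
  obtain K where K: "0 < K" "\<And>x. norm (T x) \<le> K * norm x"
    by (rule bounded_clinear_pos_bound[OF T]) (rule that)
  \<comment> \<open>Chosen so that 1 - C is \<open>cadjoint T \<circ> T\<close> divided by
    \<open>K\<^sup>2\<close>; the roots are rescaled by \<open>K\<close> and \<open>sqrt K\<close>
    at the end.\<close>
  define C where "C x = x - (1 / K\<^sup>2) *\<^sub>R cadjoint T (T x)" for x
  have C: "bounded_clinear C"
  proof -
    have "bounded_clinear (\<lambda>x. id x - (1 / K\<^sup>2) *\<^sub>R (cadjoint T \<circ> T) x)"
      by (intro bounded_clinear_diff bounded_clinear_scaleR bounded_clinear_compose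
          bounded_clinear_cadjoint bounded_clinear_id T)
    then show ?thesis by (simp add: C_def[abs_def])
  qed
  have C1: "norm (C x) \<le> norm x" for x
  proof (rule power2_le_imp_le)
    let ?y = "cadjoint T (T x)"
    have "norm ?y \<le> K * norm (T x)"
      using K by (intro norm_cadjoint_le T) auto
    then have "(norm ?y)\<^sup>2 \<le> (K * norm (T x))\<^sup>2"
      by (rule power_mono) simp
    then have "(1 / K\<^sup>2)\<^sup>2 * (norm ?y)\<^sup>2 \<le> (1 / K\<^sup>2)\<^sup>2 * (K * norm (T x))\<^sup>2"
      by (rule mult_left_mono) simp
    also have "\<dots> = (1 / K\<^sup>2) * (norm (T x))\<^sup>2"
      using K(1) by (simp add: power2_eq_square)
    finally have le: "(1 / K\<^sup>2)\<^sup>2 * (norm ?y)\<^sup>2 \<le> (1 / K\<^sup>2) * (norm (T x))\<^sup>2" .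
    have nonneg: "0 \<le> (1 / K\<^sup>2) * (norm (T x))\<^sup>2" by simp
    have ip: "inner x ?y = (norm (T x))\<^sup>2"
      by (simp add: inner_cadjoint[OF T, symmetric] power2_norm_eq_inner)
    have expand: "(norm (x - k *\<^sub>R ?y))\<^sup>2
        = (norm x)\<^sup>2 - 2 * (k * inner x ?y) + k\<^sup>2 * (norm ?y)\<^sup>2" for k
      unfolding power2_norm_eq_inner
      by (simp add: inner_diff inner_commute[of ?y x] power2_eq_square algebra_simps)
    \<comment> \<open>The cross term removes twice
      \<open>(1 / K\<^sup>2) * (norm (T x))\<^sup>2\<close>, and the square term restores at most
      once that amount.\<close>
    have "(norm (x - (1 / K\<^sup>2) *\<^sub>R ?y))\<^sup>2 \<le> (norm x)\<^sup>2"
      unfolding expand ip using le nonneg by linarith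
    then show "(norm (C x))\<^sup>2 \<le> (norm x)\<^sup>2"
      by (simp only: C_def)
  qed simp
  have self: "inner (C x) y = inner x (C y)" for x y
    by (simp add: C_def inner_cadjoint_comp[OF T] inner_diff)
  obtain P R where P: "positive_op P" "\<And>x. P (P x) = x - C x"
    and R: "positive_op R" "\<And>x. R (R x) = P x" and bi: "in_bicommutant C P"
    by (rule ex_positive_sqrt[OF C C1 self]) (rule that)
  note scP = bounded_clinear_scaleR_arg[OF positive_op_bounded_clinear[OF P(1)]]
  note scR = bounded_clinear_scaleR_arg[OF positive_op_bounded_clinear[OF R(1)]]
  show thesis
  proof (rule that)
    show "positive_op (\<lambda>x. K *\<^sub>R P x)" "positive_op (\<lambda>x. sqrt K *\<^sub>R R x)"
      using K by (auto intro!: positive_op_scaleR P R)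
    show "K *\<^sub>R P (K *\<^sub>R P x) = cadjoint T (T x)" for x
      using K(1) by (simp add: P(2) scP C_def power2_eq_square)
    show "sqrt K *\<^sub>R R (sqrt K *\<^sub>R R x) = K *\<^sub>R P x" for x
      using K(1) by (simp add: R(2) scR)
    show "in_bicommutant (cadjoint T \<circ> T) (\<lambda>x. K *\<^sub>R P x)"
    proof (rule in_bicommutantI)
      fix D :: "'a \<Rightarrow> 'a" and x
      assume D: "bounded_linear D" "\<And>x. (cadjoint T \<circ> T) (D x) = D ((cadjoint T \<circ> T) x)"
      have "C (D x) = D (C x)" for x
        using D(2)[of x] by (simp add: C_def linear_simps[OF D(1)])
      from in_bicommutantD[OF bi D(1) this, of x]
      show "K *\<^sub>R P (D x) = D (K *\<^sub>R P x)"
        by (simp add: linear_simps[OF D(1)])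
    qed
  qed
qed

text \<open>Any positive root of \<open>cadjoint T \<circ> T\<close> commutes with its own square,
  hence with the constructed root, which lies in the bicommutant of that square; commuting positive
  roots coincide.\<close>

lemma abs_op_eqI:
  fixes T :: "'a::chilbert_space \<Rightarrow> 'a"
  assumes T: "bounded_clinear T" and Q: "positive_op Q" "\<And>x. Q (Q x) = cadjoint T (T x)"
  shows "abs_op T = Q"
proof -
  obtain P where P: "positive_op P" "\<And>x. P (P x) = cadjoint T (T x)"
    "in_bicommutant (cadjoint T \<circ> T) P"
    by (rule ex_abs_op[OF T]) (rule that)
  have unique: "Q = P" if Q: "positive_op Q" "\<And>x. Q (Q x) = cadjoint T (T x)" for Q
  proof (rule positive_sqrt_unique[symmetric])
    have "(cadjoint T \<circ> T) (Q x) = Q ((cadjoint T \<circ> T) x)" for x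
      by (simp add: Q(2)[symmetric])
    then show "P (Q x) = Q (P x)" for x
      by (intro in_bicommutantD[OF P(3)] bounded_clinear_bounded_linear
          positive_op_bounded_clinear[OF Q(1)])
  qed (simp_all add: P Q)
  have "abs_op T = P"
    unfolding abs_op_def sqrt_op_def
  proof (rule the_equality)
    show "Q = P" if "positive_op Q \<and> Q \<circ> Q = cadjoint T \<circ> T" for Q
      using that by (intro unique) (auto simp: fun_eq_iff)
  qed (simp add: P fun_eq_iff)
  then show ?thesis
    using unique[OF Q] by simp
qed

lemma
  fixes T :: "'a::chilbert_space \<Rightarrow> 'a"
  assumes T: "bounded_clinear T"
  shows positive_abs_op: "positive_op (abs_op T)"
    and abs_op_abs_op: "abs_op T (abs_op T x) = cadjoint T (T x)"
    and abs_op_bicommutant: "in_bicommutant (cadjoint T \<circ> T) (abs_op T)"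
    and ex_sqrt_abs_op: "\<exists>R. positive_op R \<and> (\<forall>x. R (R x) = abs_op T x)"
proof -
  obtain P R where P: "positive_op P" "\<And>x. P (P x) = cadjoint T (T x)"
    "positive_op R" "\<And>x. R (R x) = P x" "in_bicommutant (cadjoint T \<circ> T) P"
    by (rule ex_abs_op[OF T]) (rule that)
  have "abs_op T = P"
    by (rule abs_op_eqI[OF T P(1,2)])
  with P show "positive_op (abs_op T)" "abs_op T (abs_op T x) = cadjoint T (T x)"
    "in_bicommutant (cadjoint T \<circ> T) (abs_op T)"
    "\<exists>R. positive_op R \<and> (\<forall>x. R (R x) = abs_op T x)"
    by auto
qed

lemma norm_abs_op:
  assumes T: "bounded_clinear T"
  shows "norm (abs_op T x) = norm (T x)"
  by (simp add: norm_eq_sqrt_inner positive_op_inner[OF positive_abs_op[OF T]]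
      abs_op_abs_op[OF T] inner_cadjoint[OF T])

lemma abs_op_eq_0_iff: "bounded_clinear T \<Longrightarrow> abs_op T x = 0 \<longleftrightarrow> T x = 0"
  using norm_abs_op[of T x] by (metis norm_eq_zero)

section \<open>The polar decomposition\<close>

text \<open>The map \<open>W\<close> in the proof is the orthogonal projection onto the closed
  range; self-adjointness puts the remainder into the kernel.\<close>

lemma positive_op_decomposition:
  fixes P :: "'a::chilbert_space \<Rightarrow> 'a"
  assumes P: "positive_op P"
  obtains a b where "x = a + b" "a \<in> closure (range P)" "P b = 0"
proof -
  note cP = positive_op_bounded_clinear[OF P]
  have "norm (P x) \<le> 1 * norm (P x)" for x by simp
  from range_adjoint[OF cP cP this] obtain W where
    W: "\<forall>y. W y \<in> closure (range P)" "\<forall>x y. cinner (P x) (W y) = cinner (P x) y" by blast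
  have "P (x - W x) = 0"
  proof (rule cinner_ext)
    have "cinner (P y) (x - W x) = 0" for y
      using W(2) by (simp add: cinner_diff_right)
    then show "cinner y (P (x - W x)) = cinner y 0" for y
      by (simp add: positive_op_cinner[OF P])
  qed
  then show thesis
    using that[of "W x" "x - W x"] W(1) by simp
qed

lemma bounded_linear_eq_on_closure:
  assumes "bounded_linear f" and "bounded_linear g" and "\<And>x. x \<in> X \<Longrightarrow> f x = g x"
    and "a \<in> closure X"
  shows "f a = g a"
proof -
  have "closed {x. f x = g x}"
    by (intro closed_Collect_eq linear_continuous_on assms)
  then have "closure X \<subseteq> {x. f x = g x}"
    using assms(3) by (intro closure_minimal) auto
  then show ?thesis using assms(4) by blast
qed

text \<open>The isometry condition is automatic: \<open>U (abs_op T x)\<close>, \<open>T x\<close>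
  and \<open>abs_op T x\<close> have equal norms, so \<open>U\<close> is isometric on the closed
  range of |T|, and the rest of the space is the kernel of \<open>T\<close>. This also gives the
  converse kernel inclusion, and two candidates agree on both summands.\<close>

lemma polar_op_eqI:
  fixes T U :: "'a::chilbert_space \<Rightarrow> 'a"
  assumes T: "bounded_clinear T" and U: "bounded_clinear U"
    and UP: "\<And>x. U (abs_op T x) = T x" and ker: "\<And>x. T x = 0 \<Longrightarrow> U x = 0"
  shows "polar_op T = U"
proof -
  let ?P = "abs_op T"
  note P = positive_abs_op[OF T]
  note cP = positive_op_bounded_clinear[OF P]
  have iso: "norm (U a) = norm a" if a: "a \<in> closure (range ?P)" for a
  proof -
    have "closed {x. norm (U x) = norm x}"
      by (intro closed_Collect_eq continuous_on_norm linear_continuous_on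
          bounded_clinear_bounded_linear U continuous_on_id)
    then have "closure (range ?P) \<subseteq> {x. norm (U x) = norm x}"
      by (intro closure_minimal) (auto simp: UP norm_abs_op[OF T])
    then show ?thesis using a by blast
  qed
  show ?thesis
    unfolding polar_op_def
  proof (rule the_equality, intro conjI)
    show "partial_isometry U"
      unfolding partial_isometry_def
    proof (intro conjI U allI impI)
      fix x assume x: "\<forall>y. U y = 0 \<longrightarrow> cinner y x = 0"
      \<comment> \<open>\<open>b\<close> lies in the kernel of \<open>U\<close>; being orthogonal to
        \<open>a\<close> and to \<open>x\<close>, it is 0.\<close>
      obtain a b where ab: "x = a + b" "a \<in> closure (range ?P)" "?P b = 0"
        by (rule positive_op_decomposition[OF P])
      have "U b = 0" using ab(3) ker abs_op_eq_0_iff[OF T] by blast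
      then have "inner b x = 0" using x by (simp add: inner_eq_Re_cinner)
      moreover have "inner a b = 0"
        by (rule orthogonal_closure[OF _ ab(2)]) (auto simp: positive_op_inner[OF P] ab(3))
      ultimately have "inner b b = 0"
        by (simp add: ab(1) inner_add_right inner_commute)
      then show "norm (U x) = norm x"
        using iso[OF ab(2)] ab(1) by simp
    qed
    show "{x. U x = 0} = {x. T x = 0}"
    proof (intro Collect_eqI iffI)
      fix x assume x: "U x = 0"
      obtain a b where ab: "x = a + b" "a \<in> closure (range ?P)" "?P b = 0"
        by (rule positive_op_decomposition[OF P])
      have "U b = 0" using ab(3) ker abs_op_eq_0_iff[OF T] by blast
      then have "U a = 0" using x ab(1) by (simp add: bounded_clinear_plus[OF U])
      then have "a = 0" using iso[OF ab(2)] by simp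
      then show "T x = 0" using ab(1,3) abs_op_eq_0_iff[OF T] by simp
    qed (rule ker)
    show "T = U \<circ> ?P" by (simp add: fun_eq_iff UP)
  next
    fix V assume V: "partial_isometry V \<and> {x. V x = 0} = {x. T x = 0} \<and> T = V \<circ> ?P"
    then have cV: "bounded_clinear V" by (simp add: partial_isometry_def)
    have VP: "V (?P x) = T x" for x using V by (metis comp_apply)
    show "V = U"
    proof
      fix x
      obtain a b where ab: "x = a + b" "a \<in> closure (range ?P)" "?P b = 0"
        by (rule positive_op_decomposition[OF P])
      have "T b = 0" using ab(3) abs_op_eq_0_iff[OF T] by blast
      then have "U b = 0" "V b = 0" using ker V by auto
      moreover have "V a = U a"
        by (rule bounded_linear_eq_on_closure[OF _ _ _ ab(2)])
          (auto simp: VP UP bounded_clinear_bounded_linear U cV)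
      ultimately show "V x = U x"
        by (simp add: ab(1) bounded_clinear_plus[OF U] bounded_clinear_plus[OF cV])
    qed
  qed
qed

text \<open>The polar factor is the adjoint of \<open>W\<close>, the adjoint of |T| x \<mapsto> T x.
  The location of the values of \<open>W\<close> is recorded for the kernel condition on tensor
  products.\<close>

lemma
  fixes T :: "'a::chilbert_space \<Rightarrow> 'a"
  assumes T: "bounded_clinear T"
  shows bounded_clinear_polar_op: "bounded_clinear (polar_op T)"
    and polar_op_abs_op: "polar_op T (abs_op T x) = T x"
    and polar_op_kernel: "T x = 0 \<Longrightarrow> polar_op T x = 0"
    and cadjoint_polar_op_in_closure: "cadjoint (polar_op T) x \<in> closure (range (abs_op T))"
proof -
  let ?P = "abs_op T"
  note P = positive_abs_op[OF T]
  have "norm (T x) \<le> 1 * norm (?P x)" for x by (simp add: norm_abs_op[OF T])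
  from range_adjoint[OF positive_op_bounded_clinear[OF P] T this] obtain W where
    W: "bounded_clinear W" "\<forall>y. W y \<in> closure (range ?P)"
    "\<forall>x y. cinner (?P x) (W y) = cinner (T x) y" by blast
  let ?U = "cadjoint W"
  have U: "bounded_clinear ?U" by (rule bounded_clinear_cadjoint[OF W(1)])
  have UP: "?U (?P x) = T x" for x
  proof (rule cinner_ext)
    show "cinner y (?U (?P x)) = cinner y (T x)" for y
      using W(3) cinner_commute[of "?P x" "W y"] cinner_commute[of "T x" y]
      by (simp add: cinner_cadjoint[OF W(1), symmetric])
  qed
  have ker: "?U x = 0" if "T x = 0" for x
  proof -
    have "?P x = 0" using that by (simp add: abs_op_eq_0_iff[OF T])
    \<comment> \<open>The kernel of |T| is orthogonal to the closed range, where \<open>W\<close>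
      takes its values; pairing x with W (U x) gives the squared norm of U x.\<close>
    then have "inner a x = 0" if "a \<in> range ?P" for a
      using that by (auto simp: positive_op_inner[OF P])
    then have "inner (W (?U x)) x = 0"
      by (rule orthogonal_closure[of "range ?P"]) (simp_all add: W(2))
    then show ?thesis by (simp add: inner_cadjoint[OF W(1)])
  qed
  have "polar_op T = ?U"
    by (rule polar_op_eqI[OF T U UP ker])
  then show "bounded_clinear (polar_op T)" "polar_op T (?P x) = T x"
    "T x = 0 \<Longrightarrow> polar_op T x = 0" "cadjoint (polar_op T) x \<in> closure (range ?P)"
    using U UP ker W(2) cadjoint_cadjoint[OF W(1)] by auto
qed

lemma bounded_clinear_duggal_transform:
  "bounded_clinear T \<Longrightarrow> bounded_clinear (duggal_transform T)"
  unfolding duggal_transform_def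
  by (rule bounded_clinear_compose[OF positive_op_bounded_clinear[OF positive_abs_op]
        bounded_clinear_polar_op])

text \<open>On the range of |T| the equation reads |T| T = T |T|, because U |T| = T; on the kernel
  of |T| both sides vanish. Commutation passes from \<open>cadjoint T \<circ> T\<close> to |T| by
  the bicommutant property.\<close>

lemma quasinormal_iff_duggal_transform_eq:
  fixes T :: "'a::chilbert_space \<Rightarrow> 'a"
  assumes T: "bounded_clinear T"
  shows "quasinormal T \<longleftrightarrow> duggal_transform T = T"
proof
  let ?P = "abs_op T" and ?U = "polar_op T"
  note P = positive_abs_op[OF T]
  note D = bounded_clinear_duggal_transform[OF T]
  assume "quasinormal T"
  then have "(cadjoint T \<circ> T) (T x) = T ((cadjoint T \<circ> T) x)" for x
    unfolding quasinormal_def by (metis comp_apply)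
  then have comm: "?P (T x) = T (?P x)" for x
    by (intro in_bicommutantD[OF abs_op_bicommutant[OF T]] bounded_clinear_bounded_linear[OF T])
  show "duggal_transform T = T"
  proof
    fix x
    obtain a b where ab: "x = a + b" "a \<in> closure (range ?P)" "?P b = 0"
      by (rule positive_op_decomposition[OF P])
    have "T b = 0" using ab(3) abs_op_eq_0_iff[OF T] by blast
    moreover from this have "duggal_transform T b = 0"
      by (simp add: duggal_transform_def polar_op_kernel[OF T]
          bounded_clinear_zero[OF positive_op_bounded_clinear[OF P]])
    moreover have "duggal_transform T a = T a"
      by (rule bounded_linear_eq_on_closure[OF bounded_clinear_bounded_linear[OF D]
            bounded_clinear_bounded_linear[OF T] _ ab(2)])
        (auto simp: duggal_transform_def polar_op_abs_op[OF T] comm)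
    ultimately show "duggal_transform T x = T x"
      by (simp add: ab(1) bounded_clinear_plus[OF T] bounded_clinear_plus[OF D])
  qed
next
  let ?P = "abs_op T" and ?U = "polar_op T"
  assume *: "duggal_transform T = T"
  have comm: "T (?P x) = ?P (T x)" for x
  proof -
    have "T (?P x) = duggal_transform T (?P x)" by (simp add: *)
    then show ?thesis by (simp add: duggal_transform_def polar_op_abs_op[OF T])
  qed
  show "quasinormal T"
    by (simp add: quasinormal_def fun_eq_iff abs_op_abs_op[OF T, symmetric] comm)
qed

section \<open>Tensor products of operators\<close>

locale hilbert_tensor_product =
  fixes t :: "'a::chilbert_space \<Rightarrow> 'b::chilbert_space \<Rightarrow> 'k::chilbert_space"
  assumes hilbert_tensor: "hilbert_tensor t"
begin

lemma
  shows t_add_left: "t (x + x') y = t x y + t x' y"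
    and t_add_right: "t x (y + y') = t x y + t x y'"
    and t_scaleC_left: "t (c *\<^sub>C x) y = c *\<^sub>C t x y"
    and t_scaleC_right: "t x (c *\<^sub>C y) = c *\<^sub>C t x y"
    and cinner_t: "cinner (t x y) (t x' y') = cinner x x' * cinner y y'"
    and dense: "closure (complex_vector.span {t x y | x y. True}) = UNIV"
  using hilbert_tensor by (simp_all add: hilbert_tensor_def)

lemma norm_t: "norm (t x y) = norm x * norm y"
proof -
  have "complex_of_real ((norm (t x y))\<^sup>2) = complex_of_real ((norm x * norm y)\<^sup>2)"
    using cinner_t[of x y x y] by (simp add: cinner_self power_mult_distrib)
  then show ?thesis
    by (metis of_real_eq_iff norm_ge_zero mult_nonneg_nonneg power2_eq_iff_nonneg)
qed

lemma t_scaleR_left: "t (r *\<^sub>R x) y = r *\<^sub>R t x y"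
  and t_scaleR_right: "t x (r *\<^sub>R y) = r *\<^sub>R t x y"
  by (simp_all add: scaleR_scaleC t_scaleC_left t_scaleC_right)

lemma bounded_linear_t_left: "bounded_linear (\<lambda>x. t x y)"
  by (rule bounded_linear_intro[where K = "norm y"])
    (simp_all add: t_add_left t_scaleR_left norm_t)

lemma bounded_linear_t_right: "bounded_linear (\<lambda>y. t x y)"
  by (rule bounded_linear_intro[where K = "norm x"])
    (simp_all add: t_add_right t_scaleR_right norm_t mult.commute)

lemma t_diff_left: "t (x - x') y = t x y - t x' y"
  by (rule linear_diff[OF bounded_linear.linear[OF bounded_linear_t_left]])

lemma t_diff_right: "t x (y - y') = t x y - t x y'"
  by (rule linear_diff[OF bounded_linear.linear[OF bounded_linear_t_right]])

lemma in_closure_span: "z \<in> closure (complex_vector.span {t x y | x y. True})"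
  by (subst dense) (rule UNIV_I)

lemma eq_0I:
  assumes "\<And>x y. cinner (t x y) u = 0"
  shows "u = 0"
proof -
  have "cinner z u = 0" if "z \<in> complex_vector.span {t x y | x y. True}" for z
    using that
    by (induction rule: complex_vector.span_induct_alt)
      (auto simp: cinner_add_left cinner_scaleC_left assms)
  then have "inner z u = 0" if "z \<in> complex_vector.span {t x y | x y. True}" for z
    using that by (simp only: inner_eq_Re_cinner zero_complex.sel)
  then have "inner u u = 0"
    by (rule orthogonal_closure[OF _ in_closure_span])
  then show ?thesis by simp
qed

lemma vector_eqI:
  assumes "\<And>x y. cinner (t x y) u = cinner (t x y) v"
  shows "u = v"
  using eq_0I[of "u - v"] assms by (simp add: cinner_diff_right)

lemma operator_eqI:
  assumes Q: "bounded_clinear Q" and R: "bounded_clinear R"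
    and eq: "\<And>x y. Q (t x y) = R (t x y)"
  shows "Q = R"
proof
  fix z
  have "Q z = R z" if "z \<in> complex_vector.span {t x y | x y. True}" for z
    using that
    by (induction rule: complex_vector.span_induct_alt)
      (auto simp: bounded_clinear_plus[OF Q] bounded_clinear_plus[OF R] bounded_clinear_zero[OF Q]
        bounded_clinear_zero[OF R] bounded_clinear_scaleC[OF Q] bounded_clinear_scaleC[OF R] eq)
  then show "Q z = R z"
    by (rule bounded_linear_eq_on_closure[OF bounded_clinear_bounded_linear[OF Q]
          bounded_clinear_bounded_linear[OF R] _ in_closure_span])
qed

text \<open>A list stands for a formal sum of elementary tensors, so no choice of representation
  intervenes; with the identity for \<open>S\<close> it evaluates to the vector itself.\<close>

definition ampliation_sum :: "('a \<Rightarrow> 'a) \<Rightarrow> ('a \<times> 'b) list \<Rightarrow> 'k" where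
  "ampliation_sum S L = (\<Sum>(x, y)\<leftarrow>L. t (S x) y)"

lemma ampliation_sum_Nil [simp]: "ampliation_sum S [] = 0"
  and ampliation_sum_Cons [simp]: "ampliation_sum S ((x, y) # L) = t (S x) y + ampliation_sum S L"
  and ampliation_sum_append [simp]: "ampliation_sum S (L @ M) = ampliation_sum S L + ampliation_sum S M"
  by (simp_all add: ampliation_sum_def)

lemma ampliation_sum_scaleC:
  assumes "\<And>x. S (c *\<^sub>C x) = c *\<^sub>C S x"
  shows "ampliation_sum S (map (\<lambda>(x, y). (c *\<^sub>C x, y)) L) = c *\<^sub>C ampliation_sum S L"
  by (induction L) (auto simp: assms t_scaleC_left scaleC_add_right)

text \<open>Writing \<open>K\<^sup>2 - S\<^sup>* S = R\<^sup>2\<close> bounds \<open>S \<otimes> 1\<close> on the algebraic tensor product without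
  orthonormalisation: \<open>K\<^sup>2 \<parallel>u\<parallel>\<^sup>2 - \<parallel>(S \<otimes> 1) u\<parallel>\<^sup>2 = \<parallel>(R \<otimes> 1) u\<parallel>\<^sup>2 \<ge> 0\<close>.\<close>

lemma norm_ampliation_sum_le:
  assumes S: "bounded_clinear S"
  obtains K where "\<And>L. norm (ampliation_sum S L) \<le> K * norm (ampliation_sum (\<lambda>x. x) L)"
proof -
  obtain K R where R: "positive_op R" "\<And>x. R (R x) = (K\<^sup>2) *\<^sub>R x - cadjoint S (S x)"
    by (rule ex_sqrt_bound_minus[OF S]) (rule that)
  \<comment> \<open>The polarised form is needed: it can be multiplied by \<open>cinner y y'\<close>
    and extends additively over both lists.\<close>
  have cR: "cinner (R x) (R x') + cinner (S x) (S x') = complex_of_real (K\<^sup>2) * cinner x x'" for x x'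
    by (simp add: positive_op_cinner[OF R(1)] R(2) cinner_diff_right cinner_cadjoint[OF S]
        scaleR_scaleC cinner_scaleC_right)
  have single: "cinner (t (R x) y) (ampliation_sum R M) + cinner (t (S x) y) (ampliation_sum S M)
      = complex_of_real (K\<^sup>2) * cinner (t x y) (ampliation_sum (\<lambda>x. x) M)" for x y M
  proof (induction M)
    case (Cons p M)
    obtain x' y' where p: "p = (x', y')" by fastforce
    have "cinner (t (R x) y) (t (R x') y') + cinner (t (S x) y) (t (S x') y')
        = complex_of_real (K\<^sup>2) * cinner (t x y) (t x' y')"
      using arg_cong[OF cR[of x x'], of "\<lambda>c. c * cinner y y'"]
      by (simp add: cinner_t algebra_simps)
    then show ?case
      using Cons by (simp add: p cinner_add_right algebra_simps)
  qed simp
  have sum: "cinner (ampliation_sum R L) (ampliation_sum R M) + cinner (ampliation_sum S L) (ampliation_sum S M)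
      = complex_of_real (K\<^sup>2) * cinner (ampliation_sum (\<lambda>x. x) L) (ampliation_sum (\<lambda>x. x) M)" for L M
  proof (induction L)
    case (Cons p L)
    obtain x y where p: "p = (x, y)" by fastforce
    show ?case
      using Cons single[of x y M] by (simp add: p cinner_add_left algebra_simps)
  qed simp
  show thesis
  proof (rule that)
    fix L
    have "complex_of_real ((norm (ampliation_sum R L))\<^sup>2 + (norm (ampliation_sum S L))\<^sup>2)
        = complex_of_real (K\<^sup>2 * (norm (ampliation_sum (\<lambda>x. x) L))\<^sup>2)"
      using sum[of L L] by (simp add: cinner_self)
    then have "(norm (ampliation_sum R L))\<^sup>2 + (norm (ampliation_sum S L))\<^sup>2 = K\<^sup>2 * (norm (ampliation_sum (\<lambda>x. x) L))\<^sup>2"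
      by (simp only: of_real_eq_iff)
    moreover have "0 \<le> (norm (ampliation_sum R L))\<^sup>2" by simp
    ultimately have "(norm (ampliation_sum S L))\<^sup>2 \<le> (\<bar>K\<bar> * norm (ampliation_sum (\<lambda>x. x) L))\<^sup>2"
      unfolding power_mult_distrib power2_abs by linarith
    then show "norm (ampliation_sum S L) \<le> \<bar>K\<bar> * norm (ampliation_sum (\<lambda>x. x) L)"
      by (rule power2_le_imp_le) simp
  qed
qed

text \<open>The pairs in \<open>?G\<close> form the graph of S \<otimes> 1 on the algebraic tensor
  product. \<open>W\<close> is its adjoint, and the adjoint of \<open>W\<close> is the bounded
  extension.\<close>

lemma ex_ampliation:
  assumes S: "bounded_clinear S"
  shows "\<exists>Q. bounded_clinear Q \<and> (\<forall>x y. Q (t x y) = t (S x) y)"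
proof -
  obtain K where K: "\<And>L. norm (ampliation_sum S L) \<le> K * norm (ampliation_sum (\<lambda>x. x) L)"
    by (rule norm_ampliation_sum_le[OF S]) (rule that)
  let ?G = "range (\<lambda>L. (ampliation_sum (\<lambda>x. x) L, ampliation_sum S L))"
  have scaleC: "(c *\<^sub>C a, c *\<^sub>C b) \<in> ?G" if ab: "(a, b) \<in> ?G" for a b c
  proof -
    obtain L where "a = ampliation_sum (\<lambda>x. x) L" "b = ampliation_sum S L" using ab by (elim rangeE) simp
    then show ?thesis
      by (intro range_eqI[of _ _ "map (\<lambda>(x, y). (c *\<^sub>C x, y)) L"])
        (simp add: ampliation_sum_scaleC bounded_clinear_scaleC[OF S])
  qed
  have "subspace ?G"
  proof (rule subspaceI)
    show "0 \<in> ?G" by (rule range_eqI[of _ _ "[]"]) (simp add: zero_prod_def)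
  next
    fix p q assume "p \<in> ?G" "q \<in> ?G"
    then obtain L M where "p = (ampliation_sum (\<lambda>x. x) L, ampliation_sum S L)" "q = (ampliation_sum (\<lambda>x. x) M, ampliation_sum S M)"
      by (elim rangeE)
    then show "p + q \<in> ?G" by (intro range_eqI[of _ _ "L @ M"]) simp
  next
    fix r p assume "p \<in> ?G"
    then show "r *\<^sub>R p \<in> ?G"
      using scaleC[of "fst p" "snd p" "complex_of_real r"]
      by (simp add: scaleR_prod_def scaleR_scaleC)
  qed
  moreover have "norm b \<le> K * norm a" if "(a, b) \<in> ?G" for a b
    using that K by (elim rangeE) simp
  ultimately obtain W where W: "bounded_clinear W"
    "\<forall>(a, b)\<in>?G. \<forall>z. cinner a (W z) = cinner b z"
    using graph_adjoint[of ?G K] scaleC by blast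
  have "cadjoint W (t x y) = t (S x) y" for x y
  proof (rule cinner_ext)
    fix z
    have "(t x y, t (S x) y) \<in> ?G"
      by (rule range_eqI[of _ _ "[(x, y)]"]) simp
    then have "cinner (t x y) (W z) = cinner (t (S x) y) z" using W(2) by blast
    then show "cinner z (cadjoint W (t x y)) = cinner z (t (S x) y)"
      using cinner_commute[of "W z" "t x y"] cinner_commute[of z "t (S x) y"]
      by (simp add: cinner_cadjoint[OF W(1), symmetric])
  qed
  then show ?thesis
    using bounded_clinear_cadjoint[OF W(1)] by blast
qed

text \<open>With the factors exchanged, 1 \<otimes> T becomes an ampliation of the first
  factor.\<close>

lemma flip: "hilbert_tensor_product (\<lambda>y x. t x y)"
proof
  have "{t x y | y x. True} = {t x y | x y. True}" by blast
  then show "hilbert_tensor (\<lambda>y x. t x y)"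
    using dense
    by (simp add: hilbert_tensor_def t_add_left t_add_right t_scaleC_left t_scaleC_right cinner_t
        mult.commute)
qed

text \<open>S \<otimes> T is the composite of S \<otimes> 1 and 1 \<otimes> T; density of the
  elementary tensors makes it unique.\<close>

lemma
  assumes S: "bounded_clinear S" and T: "bounded_clinear T"
  shows bounded_clinear_tensor_op: "bounded_clinear (tensor_op t S T)"
    and tensor_op: "tensor_op t S T (t x y) = t (S x) (T y)"
proof -
  obtain Q where Q: "bounded_clinear Q" "\<forall>x y. Q (t x y) = t (S x) y"
    using ex_ampliation[OF S] by blast
  obtain R where R: "bounded_clinear R" "\<forall>y x. R (t x y) = t x (T y)"
    using hilbert_tensor_product.ex_ampliation[OF flip T] by blast
  have "\<exists>!R. bounded_clinear R \<and> (\<forall>x y. R (t x y) = t (S x) (T y))"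
  proof (rule ex1I[of _ "Q \<circ> R"])
    show "bounded_clinear (Q \<circ> R) \<and> (\<forall>x y. (Q \<circ> R) (t x y) = t (S x) (T y))"
      using Q R by (simp add: bounded_clinear_compose)
    then show "V = Q \<circ> R" if "bounded_clinear V \<and> (\<forall>x y. V (t x y) = t (S x) (T y))" for V
      using that by (intro operator_eqI) simp_all
  qed
  from theI'[OF this, folded tensor_op_def]
  show "bounded_clinear (tensor_op t S T)" "tensor_op t S T (t x y) = t (S x) (T y)"
    by blast+
qed

lemma tensor_op_eqI:
  assumes "bounded_clinear S" and "bounded_clinear T" and "bounded_clinear R"
    and "\<And>x y. R (t x y) = t (S x) (T y)"
  shows "R = tensor_op t S T"
  using assms by (intro operator_eqI) (simp_all add: bounded_clinear_tensor_op tensor_op)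

section \<open>Adjoint, absolute value and polar factor of a tensor product\<close>

lemma tensor_op_compose:
  assumes "bounded_clinear S" "bounded_clinear T" "bounded_clinear S'" "bounded_clinear T'"
  shows "tensor_op t S T \<circ> tensor_op t S' T' = tensor_op t (S \<circ> S') (T \<circ> T')"
  using assms
  by (intro tensor_op_eqI) (simp_all add: bounded_clinear_compose bounded_clinear_tensor_op tensor_op)

lemma cadjoint_tensor_op:
  assumes S: "bounded_clinear S" and T: "bounded_clinear T"
  shows "cadjoint (tensor_op t S T) = tensor_op t (cadjoint S) (cadjoint T)"
proof (rule tensor_op_eqI)
  show "cadjoint (tensor_op t S T) (t x y) = t (cadjoint S x) (cadjoint T y)" for x y
  proof (rule vector_eqI)
    show "cinner (t x' y') (cadjoint (tensor_op t S T) (t x y))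
        = cinner (t x' y') (t (cadjoint S x) (cadjoint T y))" for x' y'
      by (simp add: cinner_cadjoint[OF bounded_clinear_tensor_op[OF S T], symmetric]
          tensor_op[OF S T] cinner_t cinner_cadjoint[OF S] cinner_cadjoint[OF T])
  qed
qed (intro bounded_clinear_cadjoint bounded_clinear_tensor_op S T)+

text \<open>Positivity is inherited by \<open>P \<otimes> Q = (R \<otimes> R')\<^sup>2\<close> from the self-adjoint \<open>R \<otimes> R'\<close>, where
  \<open>R\<close> and \<open>R'\<close> are the square roots of \<open>P\<close> and \<open>Q\<close>.\<close>

lemma positive_tensor_op:
  assumes R: "positive_op R" "\<And>x. R (R x) = P x" and R': "positive_op R'" "\<And>y. R' (R' y) = Q y"
  shows "positive_op (tensor_op t P Q)"
proof -
  note cR = positive_op_bounded_clinear[OF R(1)] and cR' = positive_op_bounded_clinear[OF R'(1)]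
  let ?R = "tensor_op t R R'"
  note c = bounded_clinear_tensor_op[OF cR cR']
  have PQ: "P = R \<circ> R" "Q = R' \<circ> R'" using R(2) R'(2) by auto
  have self: "inner (?R x) y = inner x (?R y)" for x y
    using inner_cadjoint[OF c, of x y]
    by (simp add: cadjoint_tensor_op[OF cR cR'] positive_op_cadjoint R(1) R'(1))
  have "tensor_op t P Q = ?R \<circ> ?R"
    unfolding PQ by (rule tensor_op_compose[OF cR cR' cR cR', symmetric])
  moreover have "positive_op (?R \<circ> ?R)"
  proof (rule positive_opI)
    show "bounded_clinear (?R \<circ> ?R)" by (rule bounded_clinear_compose[OF c c])
    show "inner ((?R \<circ> ?R) x) y = inner x ((?R \<circ> ?R) y)" for x y by (simp add: self)
    show "0 \<le> inner x ((?R \<circ> ?R) x)" for x by (metis comp_apply inner_ge_zero self)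
  qed
  ultimately show ?thesis by simp
qed

lemma abs_op_tensor_op:
  fixes S :: "'a \<Rightarrow> 'a" and T :: "'b \<Rightarrow> 'b"
  assumes S: "bounded_clinear S" and T: "bounded_clinear T"
  shows "abs_op (tensor_op t S T) = tensor_op t (abs_op S) (abs_op T)"
proof (rule abs_op_eqI)
  obtain R where "positive_op R" "\<forall>x. R (R x) = abs_op S x"
    using ex_sqrt_abs_op[OF S] by blast
  moreover obtain R' where "positive_op R'" "\<forall>x. R' (R' x) = abs_op T x"
    using ex_sqrt_abs_op[OF T] by blast
  ultimately show "positive_op (tensor_op t (abs_op S) (abs_op T))"
    by (intro positive_tensor_op[of R "abs_op S" R' "abs_op T"]) simp_all
  note cS = positive_op_bounded_clinear[OF positive_abs_op[OF S]]
  note cT = positive_op_bounded_clinear[OF positive_abs_op[OF T]]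
  have "abs_op S \<circ> abs_op S = cadjoint S \<circ> S" "abs_op T \<circ> abs_op T = cadjoint T \<circ> T"
    by (auto simp: abs_op_abs_op[OF S] abs_op_abs_op[OF T])
  then have "tensor_op t (abs_op S) (abs_op T) \<circ> tensor_op t (abs_op S) (abs_op T)
      = cadjoint (tensor_op t S T) \<circ> tensor_op t S T"
    by (simp add: cadjoint_tensor_op[OF S T] tensor_op_compose cS cT S T bounded_clinear_cadjoint)
  then show "tensor_op t (abs_op S) (abs_op T) (tensor_op t (abs_op S) (abs_op T) z)
      = cadjoint (tensor_op t S T) (tensor_op t S T z)" for z
    by (metis comp_apply)
qed (rule bounded_clinear_tensor_op[OF S T])

lemma t_closure:
  assumes "a \<in> closure (range A)" and "b \<in> closure (range B)"
    and "\<And>x y. inner (t (A x) (B y)) u = 0"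
  shows "inner (t a b) u = 0"
proof -
  have zero: "bounded_linear (\<lambda>x. 0 :: real)" by (rule bounded_linear_zero)
  have 1: "inner (t a (B y)) u = 0" for y
    by (rule bounded_linear_eq_on_closure[OF bounded_linear_inner_left_comp[OF bounded_linear_t_left]
          zero _ assms(1)]) (use assms(3) in auto)
  show ?thesis
    by (rule bounded_linear_eq_on_closure[OF bounded_linear_inner_left_comp[OF bounded_linear_t_right]
          zero _ assms(2)]) (use 1 in auto)
qed

text \<open>For z in the kernel of S \<otimes> T, self-adjointness of |S| \<otimes> |T| makes z
  orthogonal to all |S| x \<otimes> |T| y. The adjoint of U \<otimes> V sends elementary tensors to
  limits of such vectors, so (U \<otimes> V) z is orthogonal to all elementary tensors.\<close>

lemma polar_op_tensor_op:
  fixes S :: "'a \<Rightarrow> 'a" and T :: "'b \<Rightarrow> 'b"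
  assumes S: "bounded_clinear S" and T: "bounded_clinear T"
  shows "polar_op (tensor_op t S T) = tensor_op t (polar_op S) (polar_op T)"
proof (rule polar_op_eqI)
  let ?U = "polar_op S" and ?V = "polar_op T"
  let ?ST = "tensor_op t S T" and ?UV = "tensor_op t ?U ?V"
  let ?P = "tensor_op t (abs_op S) (abs_op T)"
  note cS = positive_op_bounded_clinear[OF positive_abs_op[OF S]]
  note cT = positive_op_bounded_clinear[OF positive_abs_op[OF T]]
  note cU = bounded_clinear_polar_op[OF S] and cV = bounded_clinear_polar_op[OF T]
  note cST = bounded_clinear_tensor_op[OF S T] and cUV = bounded_clinear_tensor_op[OF cU cV]
  note abs = abs_op_tensor_op[OF S T]
  show "bounded_clinear ?ST" "bounded_clinear ?UV" by (fact cST cUV)+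
  have "?UV \<circ> ?P = ?ST"
    by (rule tensor_op_eqI[OF S T bounded_clinear_compose[OF cUV bounded_clinear_tensor_op[OF cS cT]]])
      (simp add: tensor_op cS cT cU cV polar_op_abs_op S T)
  then show "?UV (abs_op ?ST z) = ?ST z" for z
    by (metis abs comp_apply)
  show "?UV z = 0" if z: "?ST z = 0" for z
  proof (rule eq_0I)
    fix x y
    have Pz: "?P z = 0"
      using z abs_op_eq_0_iff[OF cST] by (simp add: abs)
    have "inner (t (abs_op S x) (abs_op T y)) z = 0" for x y
      using positive_op_inner[OF positive_abs_op[OF cST], of "t x y" z] Pz
      by (simp add: abs tensor_op[OF cS cT])
    then have ort: "inner (t (cadjoint ?U x) (cadjoint ?V y)) z = 0" for x y
      by (rule t_closure[OF cadjoint_polar_op_in_closure[OF S] cadjoint_polar_op_in_closure[OF T]])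
    have "inner (t x y) (?UV z) = 0" for x y
    proof -
      have "inner (t x y) (?UV z) = inner (cadjoint ?UV (t x y)) z"
        using inner_cadjoint[OF cUV, of z "t x y"] by (simp add: inner_commute)
      then show ?thesis
        by (simp add: cadjoint_tensor_op[OF cU cV] tensor_op bounded_clinear_cadjoint cU cV ort)
    qed
    \<comment> \<open>The instance with \<open>\<i> *\<^sub>C x\<close> supplies the imaginary
      part.\<close>
    from this[of x y] this[of "\<i> *\<^sub>C x" y] show "cinner (t x y) (?UV z) = 0"
      by (simp add: complex_eq_iff Im_cinner t_scaleC_left) (simp add: inner_eq_Re_cinner)
  qed
qed

lemma duggal_transform_tensor_op:
  fixes S :: "'a \<Rightarrow> 'a" and T :: "'b \<Rightarrow> 'b"
  assumes S: "bounded_clinear S" and T: "bounded_clinear T"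
  shows "duggal_transform (tensor_op t S T) = tensor_op t (duggal_transform S) (duggal_transform T)"
  unfolding duggal_transform_def abs_op_tensor_op[OF S T] polar_op_tensor_op[OF S T]
  by (intro tensor_op_compose positive_op_bounded_clinear[OF positive_abs_op]
      bounded_clinear_polar_op S T)

end

section \<open>The mean transform of a tensor product\<close>

lemma bounded_clinear_mean_transform:
  "bounded_clinear T \<Longrightarrow> bounded_clinear (mean_transform l T)"
  unfolding mean_transform_def
  by (intro bounded_clinear_add bounded_clinear_scaleR bounded_clinear_duggal_transform)

theorem theorem12:
  fixes tensor :: "'h::chilbert_space \<Rightarrow> 'h \<Rightarrow> 'k::chilbert_space"
    and S T :: "'h \<Rightarrow> 'h"
    and l :: real
  assumes "hilbert_tensor tensor"
    and "bounded_clinear S" and "bounded_clinear T"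
    and "0 < l" and "l < 1"
  shows "mean_transform l (tensor_op tensor S T)
           = tensor_op tensor (mean_transform l S) (mean_transform l T)
         \<longleftrightarrow> quasinormal S \<or> quasinormal T"
proof -
  interpret hilbert_tensor_product tensor by standard fact
  note S = assms(2) and T = assms(3)
  let ?D = duggal_transform and ?M = "mean_transform l"
  note DS = bounded_clinear_duggal_transform[OF S] and DT = bounded_clinear_duggal_transform[OF T]
  note MS = bounded_clinear_mean_transform[OF S] and MT = bounded_clinear_mean_transform[OF T]
  note MST = bounded_clinear_mean_transform[OF bounded_clinear_tensor_op[OF S T]]
  \<comment> \<open>The terms S \<otimes> T and \<open>?D S\<close> \<otimes> \<open>?D T\<close>
    keep the coefficients \<open>l - l\<^sup>2\<close> and \<open>(1 - l) - (1 - l)\<^sup>2\<close>,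
    both equal to \<open>l * (1 - l)\<close>, and each mixed term has its negative; hence a single
    elementary tensor remains.\<close>
  have diff: "?M (tensor_op tensor S T) (tensor x y) - tensor_op tensor (?M S) (?M T) (tensor x y)
      = (l * (1 - l)) *\<^sub>R tensor (S x - ?D S x) (T y - ?D T y)" for x y
  proof -
    have lhs: "?M (tensor_op tensor S T) (tensor x y) = l *\<^sub>R tensor (S x) (T y)
        + (1 - l) *\<^sub>R tensor (?D S x) (?D T y)"
      by (simp add: mean_transform_def duggal_transform_tensor_op[OF S T] tensor_op[OF S T]
          tensor_op[OF DS DT])
    have rhs: "tensor_op tensor (?M S) (?M T) (tensor x y)
        = tensor (l *\<^sub>R S x + (1 - l) *\<^sub>R ?D S x) (l *\<^sub>R T y + (1 - l) *\<^sub>R ?D T y)"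
      by (simp add: tensor_op[OF MS MT]) (simp add: mean_transform_def)
    show ?thesis
      unfolding lhs rhs
      by (simp add: t_add_left t_add_right t_diff_left t_diff_right t_scaleR_left t_scaleR_right
          algebra_simps)
  qed
  have "?M (tensor_op tensor S T) = tensor_op tensor (?M S) (?M T) \<longleftrightarrow>
      (\<forall>x y. ?M (tensor_op tensor S T) (tensor x y) = tensor_op tensor (?M S) (?M T) (tensor x y))"
    using operator_eqI[OF MST bounded_clinear_tensor_op[OF MS MT]] by metis
  also have "\<dots> \<longleftrightarrow> (\<forall>x y. (l * (1 - l)) *\<^sub>R tensor (S x - ?D S x) (T y - ?D T y) = 0)"
    by (simp only: diff[symmetric] right_minus_eq)
  also have "\<dots> \<longleftrightarrow> (\<forall>x y. norm (tensor (S x - ?D S x) (T y - ?D T y)) = 0)"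
    using assms(4,5) by simp
  also have "\<dots> \<longleftrightarrow> (\<forall>x y. S x = ?D S x \<or> T y = ?D T y)"
    by (simp add: norm_t)
  \<comment> \<open>\<open>x\<close> and \<open>y\<close> vary independently, so a witness against
    each equation would together refute the pointwise disjunction.\<close>
  also have "\<dots> \<longleftrightarrow> ?D S = S \<or> ?D T = T"
    by (auto simp: fun_eq_iff)
  also have "\<dots> \<longleftrightarrow> quasinormal S \<or> quasinormal T"
    by (simp only: quasinormal_iff_duggal_transform_eq[OF S] quasinormal_iff_duggal_transform_eq[OF T])
  finally show ?thesis .
qed

end
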